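(* Let $n\geq 4$ be finite. There is no non-Boolean line-symmetric orthoset of rank $n$ that embeds into every other non-Boolean line-symmetric orthoset of rank $n$.
   Context: An orthoset is a set $X$ with a symmetric, irreflexive binary relation $\perp$. Its rank is the supremum of the cardinalities of subsets consisting of mutually orthogonal elements. For $A\subseteq X$, $A^\perp=\{e\in X: e\perp f \text{ for all } f\in A\}$; $A$ is orthoclosed if $A=A^{\perp\perp}$. The orthoset is Boolean if any two distinct elements are orthogonal. An embedding of orthosets is an injective map $\varphi$ with $e\perp f\Leftrightarrow\varphi(e)\perp\varphi(f)$; $X$ embeds into $Y$ if there is an embedding $X\to Y$. An automorphism is a bijective embedding of $X$ into itself. $\mathrm{Aut}(X)$ is the group of automorphisms, and for orthoclosed $A$, $\mathrm{Aut}(X,A)=\{\varphi\in\mathrm{Aut}(X):\varphi|_{A^\perp}=\mathrm{id}_{A^\perp}\}$. A line is a set of the form $\{e,f\}^{\perp\perp}$ with $e\neq f$ in $X$. $(X,\perp)$ is line-symmetric if for any lines $\ell,m$ there is an automorphism $\varphi$ with $\varphi(\ell)=m$, and for every line $\ell$ the group $\mathrm{Aut}(X,\ell)$ leaves $\ell$ invariant and acts transitively on $\ell$. *)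

theory Defs
  imports "HOL-Library.Extended_Nat" "HOL-Library.FuncSet"
begin

text \<open>
  An orthoset is a carrier set \<open>X\<close> together with a relation \<open>R\<close> on the ambient type, of which
  only the restriction to \<open>X\<close> matters.
\<close>

definition orthoset :: "'a set \<Rightarrow> ('a \<Rightarrow> 'a \<Rightarrow> bool) \<Rightarrow> bool" where
  "orthoset X R \<longleftrightarrow> symp_on X R \<and> irreflp_on X R"

definition orthoset_rank :: "'a set \<Rightarrow> ('a \<Rightarrow> 'a \<Rightarrow> bool) \<Rightarrow> enat" where
  \<comment> \<open>All infinite cardinalities are identified with \<open>\<infinity>\<close>; only finite values are ever used.\<close>
  "orthoset_rank X R =
     (SUP A \<in> {A. A \<subseteq> X \<and> pairwise R A}. if finite A then enat (card A) else \<infinity>)"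

definition boolean_orthoset :: "'a set \<Rightarrow> ('a \<Rightarrow> 'a \<Rightarrow> bool) \<Rightarrow> bool" where
  "boolean_orthoset X R \<longleftrightarrow> pairwise R X"

definition orthocomp :: "'a set \<Rightarrow> ('a \<Rightarrow> 'a \<Rightarrow> bool) \<Rightarrow> 'a set \<Rightarrow> 'a set" where
  "orthocomp X R A = {e \<in> X. \<forall>f\<in>A. R e f}"

definition orthoset_lines :: "'a set \<Rightarrow> ('a \<Rightarrow> 'a \<Rightarrow> bool) \<Rightarrow> 'a set set" where
  "orthoset_lines X R =
     {orthocomp X R (orthocomp X R {e, f}) | e f. e \<in> X \<and> f \<in> X \<and> e \<noteq> f}"

definition orthoset_embedding ::
    "'a set \<Rightarrow> ('a \<Rightarrow> 'a \<Rightarrow> bool) \<Rightarrow> 'b set \<Rightarrow> ('b \<Rightarrow> 'b \<Rightarrow> bool) \<Rightarrow> ('a \<Rightarrow> 'b) \<Rightarrow> bool" where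
  "orthoset_embedding X R Y S \<phi> \<longleftrightarrow>
     \<phi> \<in> X \<rightarrow> Y \<and> inj_on \<phi> X \<and> (\<forall>e\<in>X. \<forall>f\<in>X. R e f \<longleftrightarrow> S (\<phi> e) (\<phi> f))"

definition embeds_into ::
    "'a set \<Rightarrow> ('a \<Rightarrow> 'a \<Rightarrow> bool) \<Rightarrow> 'b set \<Rightarrow> ('b \<Rightarrow> 'b \<Rightarrow> bool) \<Rightarrow> bool" where
  "embeds_into X R Y S \<longleftrightarrow> (\<exists>\<phi>. orthoset_embedding X R Y S \<phi>)"

text \<open>
  Automorphisms are taken as functions on the whole type, with arbitrary values outside \<open>X\<close>;
  only their action on \<open>X\<close> is used.
\<close>

definition Aut :: "'a set \<Rightarrow> ('a \<Rightarrow> 'a \<Rightarrow> bool) \<Rightarrow> ('a \<Rightarrow> 'a) set" where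
  "Aut X R = {\<phi>. orthoset_embedding X R X R \<phi> \<and> bij_betw \<phi> X X}"

definition Aut_rel :: "'a set \<Rightarrow> ('a \<Rightarrow> 'a \<Rightarrow> bool) \<Rightarrow> 'a set \<Rightarrow> ('a \<Rightarrow> 'a) set" where
  "Aut_rel X R A = {\<phi> \<in> Aut X R. \<forall>e \<in> orthocomp X R A. \<phi> e = e}"

definition line_symmetric :: "'a set \<Rightarrow> ('a \<Rightarrow> 'a \<Rightarrow> bool) \<Rightarrow> bool" where
  "line_symmetric X R \<longleftrightarrow>
     (\<forall>l \<in> orthoset_lines X R. \<forall>m \<in> orthoset_lines X R. \<exists>\<phi> \<in> Aut X R. \<phi> ` l = m) \<and>
     (\<forall>l \<in> orthoset_lines X R.
        (\<forall>\<phi> \<in> Aut_rel X R l. \<phi> ` l = l) \<and>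
        (\<forall>e \<in> l. \<forall>f \<in> l. \<exists>\<phi> \<in> Aut_rel X R l. \<phi> e = f))"

definition nonboolean_line_symmetric_orthoset ::
    "nat \<Rightarrow> 'a set \<Rightarrow> ('a \<Rightarrow> 'a \<Rightarrow> bool) \<Rightarrow> bool" where
  "nonboolean_line_symmetric_orthoset n X R \<longleftrightarrow>
     orthoset X R \<and> \<not> boolean_orthoset X R \<and> line_symmetric X R \<and> orthoset_rank X R = enat n"

text \<open>
  HOL cannot quantify over types inside a formula, so a statement about all orthosets \<open>Y\<close> into
  which a given \<open>X\<close> embeds has to let \<open>Y\<close> range over the subsets of a fixed type \<open>'b\<close>. For a
  refutation of "\<open>X\<close> embeds into every \<open>Y\<close>" this is no restriction: the smaller the range of
  \<open>Y\<close>, the stronger the refutation. The type \<open>'b\<close> must be infinite, because otherwise its subsets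
  may carry no non-Boolean line-symmetric orthoset of the given rank at all, and the condition on
  \<open>X\<close> would hold vacuously.
\<close>

end

theory Submission
  imports Defs "HOL-Library.Countable_Set" "HOL-Library.Function_Algebras" Complex_Main
begin

text \<open>
  If \<open>K\<close> is a subfield of \<open>\<complex>\<close>, closed under conjugation, such that the norms \<open>\<bar>c\<bar>\<^sup>2\<close> with \<open>c \<in> K\<close> are
  closed under addition, then the lines of the Hermitian space \<open>K\<^sup>n\<close> form a line-symmetric orthoset of
  rank \<open>n\<close>. Two such fields suffice. The first is a countable real field \<open>E\<close> closed under square roots.
  The second is \<open>F = M(\<i>)\<close>, where \<open>M\<close> is a maximal subfield of \<open>E\<close> not containing \<open>\<surd>2\<close>: by
  maximality, every positive element of \<open>M\<close> has the form \<open>t\<^sup>2\<close> or \<open>2 t\<^sup>2 = \<bar>t + t\<i>\<bar>\<^sup>2\<close>, and \<open>F\<close> does not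
  contain \<open>\<surd>2\<close> either.

  Suppose that \<open>X\<close> embeds into both models. The line symmetry of \<open>X\<close> provides orthogonal vectors
  \<open>v\<^sub>1\<close>, \<open>v\<^sub>2\<close> of equal length and an automorphism \<open>\<alpha>\<close> that takes \<open>v\<^sub>1\<close> to \<open>s (v\<^sub>1 + v\<^sub>2)\<close> and \<open>v\<^sub>2\<close> to
  \<open>t (v\<^sub>1 - v\<^sub>2)\<close>, while it fixes a line orthogonal to both; since \<open>n \<ge> 4\<close>, this line keeps \<open>\<alpha>\<close> from
  acting on scalars and from changing lengths, so that \<open>2 \<bar>s\<bar>\<^sup>2 = 2 \<bar>t\<bar>\<^sup>2 = 1\<close>. In the real embedding this
  forces \<open>\<alpha>\<^sup>2 v\<^sub>1\<close> to be \<open>v\<^sub>1\<close> or \<open>v\<^sub>2\<close>, a property of \<open>X\<close> alone. In the embedding over \<open>F\<close> it says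
  \<open>2 s\<^sup>2 = 1\<close>, so that \<open>\<surd>2 \<in> F\<close>, a contradiction.
\<close>

section \<open>Hermitian spaces\<close>

definition smul :: "complex \<Rightarrow> (nat \<Rightarrow> complex) \<Rightarrow> nat \<Rightarrow> complex" (infixr "\<cdot>" 75) where
  "c \<cdot> v = (\<lambda>i. c * v i)"

lemma smul_apply [simp]: "(c \<cdot> v) i = c * v i"
  by (simp add: smul_def)

lemma smul_simps [simp]: "1 \<cdot> v = v" "0 \<cdot> v = 0" "c \<cdot> 0 = 0" "a \<cdot> b \<cdot> v = (a * b) \<cdot> v"
  by (auto simp: fun_eq_iff)

lemma smul_distrib: "c \<cdot> (u + v) = c \<cdot> u + c \<cdot> v" "c \<cdot> (u - v) = c \<cdot> u - c \<cdot> v"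
  by (auto simp: fun_eq_iff algebra_simps)

lemma smul_eq_0_iff: "c \<cdot> v = 0 \<longleftrightarrow> c = 0 \<or> v = 0"
  by (auto simp: fun_eq_iff)

definition herm :: "nat \<Rightarrow> (nat \<Rightarrow> complex) \<Rightarrow> (nat \<Rightarrow> complex) \<Rightarrow> complex" where
  "herm n u v = (\<Sum>i<n. u i * cnj (v i))"

definition normsq :: "nat \<Rightarrow> (nat \<Rightarrow> complex) \<Rightarrow> real" where
  "normsq n v = (\<Sum>i<n. (cmod (v i))\<^sup>2)"

text \<open>Vectors are total functions on \<open>nat\<close>. Forcing the coordinates from
  \<open>n\<close> on to vanish makes equality of functions agree with equality in
  \<open>K\<^sup>n\<close> and makes \<open>herm n\<close> definite.\<close>

definition vecs :: "nat \<Rightarrow> complex set \<Rightarrow> (nat \<Rightarrow> complex) set" where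
  "vecs n K = {v. (\<forall>i. v i \<in> K) \<and> (\<forall>i\<ge>n. v i = 0)}"

lemma herm_linear [simp]:
  "herm n (u + u') v = herm n u v + herm n u' v"
  "herm n (u - u') v = herm n u v - herm n u' v"
  "herm n (c \<cdot> u) v = c * herm n u v"
  "herm n 0 v = 0"
  "herm n u (v + v') = herm n u v + herm n u v'"
  "herm n u (v - v') = herm n u v - herm n u v'"
  "herm n u (c \<cdot> v) = cnj c * herm n u v"
  "herm n u 0 = 0"
  by (simp_all add: herm_def algebra_simps sum.distrib sum_subtractf sum_distrib_left)

lemma sum_fun_apply: "(\<Sum>i\<in>I. f i) x = (\<Sum>i\<in>I. f i x :: complex)"
  by (induction I rule: infinite_finite_induct) auto

lemma herm_sum_left:
  fixes f :: "'i \<Rightarrow> nat \<Rightarrow> complex"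
  shows "herm n (\<Sum>i\<in>I. f i) v = (\<Sum>i\<in>I. herm n (f i) v)"
  unfolding herm_def sum_fun_apply sum_distrib_right by (rule sum.swap)

lemma herm_sum_right:
  fixes f :: "'i \<Rightarrow> nat \<Rightarrow> complex"
  shows "herm n u (\<Sum>i\<in>I. f i) = (\<Sum>i\<in>I. herm n u (f i))"
  unfolding herm_def sum_fun_apply cnj_sum sum_distrib_left by (rule sum.swap)

lemma cnj_herm: "cnj (herm n u v) = herm n v u"
  by (simp add: herm_def mult.commute)

lemma herm_eq_0_sym: "herm n u v = 0 \<longleftrightarrow> herm n v u = 0"
  by (metis cnj_herm complex_cnj_zero_iff)

lemma herm_self: "herm n v v = of_real (normsq n v)"
  by (simp add: herm_def normsq_def complex_mult_cnj cmod_power2)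

lemma cnj_herm_self [simp]: "cnj (herm n v v) = herm n v v"
  by (simp add: herm_self)

lemma normsq_nonneg: "normsq n v \<ge> 0"
  by (simp add: normsq_def sum_nonneg)

lemma normsq_eq_iff: "normsq n u = normsq n v \<longleftrightarrow> herm n u u = herm n v v"
  by (simp add: herm_self)

lemma normsq_smul: "normsq n (c \<cdot> v) = (cmod c)\<^sup>2 * normsq n v"
  by (simp add: normsq_def norm_mult power_mult_distrib sum_distrib_left)

lemma normsq_eq_0_iff:
  assumes "v \<in> vecs n K"
  shows "normsq n v = 0 \<longleftrightarrow> v = 0"
proof -
  have "normsq n v = 0 \<longleftrightarrow> (\<forall>i<n. v i = 0)"
    by (auto simp: normsq_def sum_nonneg_eq_0_iff)
  also have "\<dots> \<longleftrightarrow> v = 0"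
  proof
    assume "\<forall>i<n. v i = 0"
    then have "v i = 0" for i
      using assms by (cases "i < n") (auto simp: vecs_def)
    then show "v = 0" by (simp add: fun_eq_iff)
  qed simp
  finally show ?thesis .
qed

lemma herm_self_eq_0_iff:
  assumes "v \<in> vecs n K"
  shows "herm n v v = 0 \<longleftrightarrow> v = 0"
  using normsq_eq_0_iff[OF assms] by (simp add: herm_self)

definition unit_vec :: "nat \<Rightarrow> nat \<Rightarrow> complex" where
  "unit_vec k = (\<lambda>i. if i = k then 1 else 0)"

lemma herm_unit_vec: "k < n \<Longrightarrow> herm n (unit_vec k) v = cnj (v k)"
  by (simp add: herm_def unit_vec_def if_distrib [of "\<lambda>x. x * _"] cong: if_cong)

lemma normsq_unit_vec: "k < n \<Longrightarrow> normsq n (unit_vec k) = 1"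
  by (simp add: normsq_def unit_vec_def if_distrib [of "\<lambda>x. cmod x ^ 2"] cong: if_cong)

section \<open>Orthogonal projections and Bessel's inequality\<close>

definition fourier_sum :: "nat \<Rightarrow> 'i set \<Rightarrow> ('i \<Rightarrow> nat \<Rightarrow> complex) \<Rightarrow> (nat \<Rightarrow> complex) \<Rightarrow> nat \<Rightarrow> complex" where
  "fourier_sum n I b v = (\<Sum>i\<in>I. (herm n v (b i) / herm n (b i) (b i)) \<cdot> b i)"

text \<open>Pythagoras for the projection of \<open>v\<close> onto the span of \<open>b\<close>. The
  family is orthogonal but not normalized, since \<open>K\<close> need not contain the lengths of
  its vectors.\<close>

lemma normsq_diff_fourier_sum:
  assumes "finite I" and orth: "\<And>i j. i \<in> I \<Longrightarrow> j \<in> I \<Longrightarrow> i \<noteq> j \<Longrightarrow> herm n (b i) (b j) = 0"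
    and nz: "\<And>i. i \<in> I \<Longrightarrow> normsq n (b i) \<noteq> 0"
  shows "normsq n (v - fourier_sum n I b v) =
    normsq n v - (\<Sum>i\<in>I. (cmod (herm n v (b i)))\<^sup>2 / normsq n (b i))"
proof -
  let ?P = "fourier_sum n I b v"
  have coeff: "herm n ?P (b j) = herm n v (b j)" if "j \<in> I" for j
  proof -
    have "herm n ?P (b j) =
        (\<Sum>i\<in>I. if i = j then herm n v (b j) else 0)"
      unfolding fourier_sum_def herm_sum_left
      by (rule sum.cong) (use orth nz that in \<open>auto simp: herm_self\<close>)
    then show ?thesis using that assms(1) by simp
  qed
  \<comment> \<open>Used for \<open>w = v\<close> and \<open>w = ?P\<close>: both inner products
    with \<open>?P\<close> are the same real sum, so the cross terms of the expanded square
    collapse.\<close>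
  have sq: "herm n w ?P = (\<Sum>i\<in>I. of_real ((cmod (herm n v (b i)))\<^sup>2 / normsq n (b i)))"
    if "\<And>i. i \<in> I \<Longrightarrow> herm n w (b i) = herm n v (b i)" for w
    unfolding fourier_sum_def herm_sum_right
    by (rule sum.cong) (auto simp: that herm_self mult.commute[of "cnj _"] simp flip: complex_norm_square)
  have "herm n (v - ?P) (v - ?P) = herm n v v - cnj (herm n v ?P)"
    using sq[of v] sq[of ?P] by (simp add: coeff flip: cnj_herm[of n v ?P])
  also have "\<dots> = of_real (normsq n v - (\<Sum>i\<in>I. (cmod (herm n v (b i)))\<^sup>2 / normsq n (b i)))"
    by (simp add: herm_self sq)
  finally show ?thesis unfolding herm_self of_real_eq_iff .
qed

text \<open>Summing Bessel's inequality over the standard basis gives \<open>card I \<le> n\<close>; if \<open>card I = n\<close>,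
  every single inequality is an equality.\<close>

lemma
  assumes "finite I" and orth: "\<And>i j. i \<in> I \<Longrightarrow> j \<in> I \<Longrightarrow> i \<noteq> j \<Longrightarrow> herm n (b i) (b j) = 0"
    and vecs: "\<And>i. i \<in> I \<Longrightarrow> b i \<in> vecs n K" and nz: "\<And>i. i \<in> I \<Longrightarrow> b i \<noteq> 0"
  shows card_orthogonal_le: "card I \<le> n"
    and orthogonal_basis: "card I = n \<Longrightarrow> v \<in> vecs n K \<Longrightarrow> v = fourier_sum n I b v"
proof -
  have nz': "normsq n (b i) \<noteq> 0" if "i \<in> I" for i
    using normsq_eq_0_iff vecs nz that by blast
  \<comment> \<open>The squared length of the projection of the \<open>k\<close>-th unit vector.
    Summed over \<open>k\<close> it is the trace of the projection, hence its rank
    \<open>card I\<close>.\<close>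
  define B where "B k = (\<Sum>i\<in>I. (cmod (b i k))\<^sup>2 / normsq n (b i))" for k
  have defect: "normsq n (unit_vec k - fourier_sum n I b (unit_vec k)) = 1 - B k" if "k < n" for k
    using normsq_diff_fourier_sum[of I n b "unit_vec k"] that orth nz' \<open>finite I\<close>
    by (simp add: B_def herm_unit_vec normsq_unit_vec)
  have le: "B k \<le> 1" if "k < n" for k
    using defect[OF that] normsq_nonneg[of n "unit_vec k - fourier_sum n I b (unit_vec k)"] by linarith
  have "(\<Sum>k<n. B k) = (\<Sum>i\<in>I. \<Sum>k<n. (cmod (b i k))\<^sup>2 / normsq n (b i))"
    unfolding B_def by (rule sum.swap)
  also have "\<dots> = (\<Sum>i\<in>I. 1)"
    by (rule sum.cong) (use nz' in \<open>auto simp: normsq_def simp flip: sum_divide_distrib\<close>)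
  finally have total: "(\<Sum>k<n. B k) = card I" by simp
  have "(\<Sum>k<n. B k) \<le> (\<Sum>k<n. 1)" by (rule sum_mono) (use le in auto)
  then show "card I \<le> n" using total by simp
  assume card: "card I = n" and v: "v \<in> vecs n K"
  have "(\<Sum>k<n. 1 - B k) = 0" using total card by (simp add: sum_subtractf)
  then have "\<forall>k\<in>{..<n}. 1 - B k = 0"
    by (subst (asm) sum_nonneg_eq_0_iff) (use le in auto)
  then have "normsq n (unit_vec k - fourier_sum n I b (unit_vec k)) = 0" if "k < n" for k
    using defect that by simp
  then have exact: "fourier_sum n I b (unit_vec k) j = unit_vec k j" if "k < n" "j < n" for k j
    using that unfolding normsq_def by (subst (asm) sum_nonneg_eq_0_iff) auto
  \<comment> \<open>Fourier sums are linear in \<open>v\<close>, so exactness on the unit vectors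
    extends to every vector; beyond \<open>n\<close> both sides vanish.\<close>
  show "v = fourier_sum n I b v"
  proof
    fix j
    show "v j = fourier_sum n I b v j"
    proof (cases "j < n")
      case True
      have "fourier_sum n I b v j =
          (\<Sum>i\<in>I. \<Sum>k<n. v k * ((cnj (b i k) / herm n (b i) (b i)) * b i j))"
        unfolding fourier_sum_def sum_fun_apply
        by (rule sum.cong)
          (auto simp: herm_def[of n v] sum_distrib_right sum_divide_distrib mult.assoc)
      also have "\<dots> = (\<Sum>k<n. v k * fourier_sum n I b (unit_vec k) j)"
        by (subst sum.swap)
          (simp add: fourier_sum_def sum_fun_apply herm_unit_vec sum_distrib_left)
      also have "\<dots> = (\<Sum>k<n. v k * unit_vec k j)"
        by (rule sum.cong) (use True exact in auto)
      also have "\<dots> = v j"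
        using True by (simp add: unit_vec_def if_distrib [of "\<lambda>x. _ * x"] cong: if_cong)
      finally show ?thesis by simp
    next
      case False
      then have "b i j = 0" if "i \<in> I" for i using vecs[OF that] by (auto simp: vecs_def)
      then show ?thesis using v False by (simp add: vecs_def fourier_sum_def sum_fun_apply)
    qed
  qed
qed

definition reject :: "nat \<Rightarrow> (nat \<Rightarrow> complex) \<Rightarrow> (nat \<Rightarrow> complex) \<Rightarrow> nat \<Rightarrow> complex" where
  \<comment> \<open>For \<open>v = 0\<close> the coefficient is \<open>0 / 0 = 0\<close>, so that \<open>reject n 0 w = w\<close>.\<close>
  "reject n v w = w - (herm n w v / herm n v v) \<cdot> v"

section \<open>Subfields of the complex numbers closed under conjugation\<close>

locale conj_field =
  fixes K :: "complex set"
  assumes one_in: "1 \<in> K"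
    and diff_in: "a \<in> K \<Longrightarrow> b \<in> K \<Longrightarrow> a - b \<in> K"
    and mult_in: "a \<in> K \<Longrightarrow> b \<in> K \<Longrightarrow> a * b \<in> K"
    and inverse_in: "a \<in> K \<Longrightarrow> inverse a \<in> K"
    and cnj_in: "a \<in> K \<Longrightarrow> cnj a \<in> K"
begin

lemma zero_in: "0 \<in> K"
  using diff_in[OF one_in one_in] by simp

lemma minus_in: "a \<in> K \<Longrightarrow> - a \<in> K"
  using diff_in[OF zero_in] by simp

lemma add_in: "a \<in> K \<Longrightarrow> b \<in> K \<Longrightarrow> a + b \<in> K"
  using diff_in[OF _ minus_in] by simp

lemma divide_in: "a \<in> K \<Longrightarrow> b \<in> K \<Longrightarrow> a / b \<in> K"
  by (simp add: divide_inverse mult_in inverse_in)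

lemma sum_in: "(\<And>i. i \<in> I \<Longrightarrow> f i \<in> K) \<Longrightarrow> sum f I \<in> K"
  by (induction I rule: infinite_finite_induct) (auto simp: zero_in add_in)

lemmas field_in = zero_in one_in minus_in add_in diff_in mult_in inverse_in divide_in cnj_in

lemma vecs_add: "u \<in> vecs n K \<Longrightarrow> v \<in> vecs n K \<Longrightarrow> u + v \<in> vecs n K"
  and vecs_diff: "u \<in> vecs n K \<Longrightarrow> v \<in> vecs n K \<Longrightarrow> u - v \<in> vecs n K"
  and vecs_smul: "c \<in> K \<Longrightarrow> v \<in> vecs n K \<Longrightarrow> c \<cdot> v \<in> vecs n K"
  and vecs_zero: "0 \<in> vecs n K"
  by (auto simp: vecs_def field_in)

lemma herm_in: "u \<in> vecs n K \<Longrightarrow> v \<in> vecs n K \<Longrightarrow> herm n u v \<in> K"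
  by (auto simp: herm_def vecs_def intro!: sum_in field_in)

lemma vecs_reject: "v \<in> vecs n K \<Longrightarrow> w \<in> vecs n K \<Longrightarrow> reject n v w \<in> vecs n K"
  unfolding reject_def by (intro vecs_diff vecs_smul divide_in herm_in)

lemmas vecs_in = vecs_zero vecs_add vecs_diff vecs_smul vecs_reject

lemma herm_reject: "v \<in> vecs n K \<Longrightarrow> herm n (reject n v w) v = 0"
  using herm_self_eq_0_iff[of v n K] by (auto simp: reject_def)

lemma smul_vecs_imp_in:
  assumes "c \<cdot> v \<in> vecs n K" "v \<in> vecs n K" "v \<noteq> 0"
  shows "c \<in> K"
proof -
  obtain i where i: "v i \<noteq> 0" using assms(3) by (auto simp: fun_eq_iff)
  have "c * v i \<in> K" "v i \<in> K" using assms(1,2) by (auto simp: vecs_def)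
  from divide_in[OF this] i show ?thesis by simp
qed

end

section \<open>Orthosets represented by lines of a Hermitian space\<close>

text \<open>Distinct points span distinct lines, but not every line of \<open>K\<^sup>n\<close> has
  to come from a point. This covers the full models as well as any orthoset embedded in one of
  them.\<close>

locale herm_rep = conj_field +
  fixes n :: nat and X :: "'a set" and R :: "'a \<Rightarrow> 'a \<Rightarrow> bool" and \<psi> :: "'a \<Rightarrow> nat \<Rightarrow> complex"
  assumes \<psi>_vecs: "x \<in> X \<Longrightarrow> \<psi> x \<in> vecs n K"
    and \<psi>_nonzero: "x \<in> X \<Longrightarrow> \<psi> x \<noteq> 0"
    and \<psi>_orth: "x \<in> X \<Longrightarrow> y \<in> X \<Longrightarrow> R x y \<longleftrightarrow> herm n (\<psi> x) (\<psi> y) = 0"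
    and \<psi>_inj: "x \<in> X \<Longrightarrow> y \<in> X \<Longrightarrow> \<psi> x = c \<cdot> \<psi> y \<Longrightarrow> x = y"
begin

abbreviation ip (infix "\<bullet>" 72) where "u \<bullet> v \<equiv> herm n u v"
abbreviation "V \<equiv> vecs n K"

text \<open>A point is related to every nonzero vector of \<open>K\<^sup>n\<close> on its line, so
  that representatives can be rescaled to suit each argument.\<close>

definition rep :: "'a \<Rightarrow> (nat \<Rightarrow> complex) \<Rightarrow> bool" where
  "rep x v \<longleftrightarrow> x \<in> X \<and> v \<in> V \<and> v \<noteq> 0 \<and> (\<exists>c. v = c \<cdot> \<psi> x)"

lemma rep_\<psi>: "x \<in> X \<Longrightarrow> rep x (\<psi> x)"
  unfolding rep_def using \<psi>_vecs \<psi>_nonzero smul_simps(1) by metis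

lemma repD: "rep x v \<Longrightarrow> x \<in> X" "rep x v \<Longrightarrow> v \<in> V" "rep x v \<Longrightarrow> v \<noteq> 0"
  by (auto simp: rep_def)

lemma rep_pos: "rep x v \<Longrightarrow> v \<bullet> v \<noteq> 0"
  using herm_self_eq_0_iff repD by blast

lemma rep_smul: "rep x v \<Longrightarrow> c \<in> K \<Longrightarrow> c \<noteq> 0 \<Longrightarrow> rep x (c \<cdot> v)"
  unfolding rep_def using vecs_smul smul_eq_0_iff smul_simps(4) by metis

lemma rep_proportional:
  assumes "rep x u" "rep x v"
  obtains c where "c \<in> K" "c \<noteq> 0" "v = c \<cdot> u"
proof -
  obtain a b where ab: "u = a \<cdot> \<psi> x" "v = b \<cdot> \<psi> x"
    using assms by (auto simp: rep_def)
  then have "a \<noteq> 0" "b \<noteq> 0" using repD(3)[OF assms(1)] repD(3)[OF assms(2)] by auto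
  then have v: "v = (b / a) \<cdot> u" using ab by simp
  then have "b / a \<in> K" using smul_vecs_imp_in repD assms by metis
  with v that \<open>a \<noteq> 0\<close> \<open>b \<noteq> 0\<close> show ?thesis by simp
qed

lemma rep_unique:
  assumes "rep x u" "rep y (c \<cdot> u)"
  shows "x = y"
proof -
  obtain a b where "u = a \<cdot> \<psi> x" "c \<cdot> u = b \<cdot> \<psi> y"
    using assms by (auto simp: rep_def)
  then have "b \<cdot> \<psi> y = (c * a) \<cdot> \<psi> x" by simp
  moreover have "b \<noteq> 0" using assms(2) \<open>c \<cdot> u = b \<cdot> \<psi> y\<close> by (auto simp: rep_def)
  ultimately have "\<psi> y = (c * a / b) \<cdot> \<psi> x"
    by (auto simp: fun_eq_iff field_simps)
  then show ?thesis using \<psi>_inj assms repD(1) by metis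
qed

lemma rep_unique': "rep x u \<Longrightarrow> rep y u \<Longrightarrow> x = y"
  using rep_unique[of x u y 1] by simp

lemma rep_orth:
  assumes "rep x u" "rep y v"
  shows "R x y \<longleftrightarrow> u \<bullet> v = 0"
proof -
  obtain a b where "u = a \<cdot> \<psi> x" "v = b \<cdot> \<psi> y" "a \<noteq> 0" "b \<noteq> 0"
    using assms unfolding rep_def by (metis smul_simps(2))
  then show ?thesis using \<psi>_orth assms repD(1) by auto
qed

lemma R_sym: "x \<in> X \<Longrightarrow> y \<in> X \<Longrightarrow> R x y \<longleftrightarrow> R y x"
  using \<psi>_orth herm_eq_0_sym by blast

lemma R_irrefl: "x \<in> X \<Longrightarrow> \<not> R x x"
  using rep_\<psi> rep_pos rep_orth by blast

lemma orthoset: "orthoset X R"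
  unfolding orthoset_def using R_sym R_irrefl by (auto intro!: symp_onI irreflp_onI)

lemma card_pairwise_orthogonal_le:
  assumes "A \<subseteq> X" "pairwise R A" "finite A"
  shows "card A \<le> n"
proof (rule card_orthogonal_le[where b = \<psi>])
  show "herm n (\<psi> x) (\<psi> y) = 0" if "x \<in> A" "y \<in> A" "x \<noteq> y" for x y
    using that assms \<psi>_orth by (metis pairwiseD subset_iff)
qed (use assms \<psi>_vecs \<psi>_nonzero in auto)

lemma orthogonal_basis_expansion:
  assumes "A \<subseteq> X" "pairwise R A" "finite A" "card A = n" "v \<in> V"
  shows "v = fourier_sum n A \<psi> v"
proof (rule orthogonal_basis[where b = \<psi>])
  show "herm n (\<psi> x) (\<psi> y) = 0" if "x \<in> A" "y \<in> A" "x \<noteq> y" for x y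
    using that assms \<psi>_orth by (metis pairwiseD subset_iff)
qed (use assms \<psi>_vecs \<psi>_nonzero in auto)

end

section \<open>Automorphisms and lines of orthosets\<close>

lemma AutD:
  assumes "\<phi> \<in> Aut X R"
  shows Aut_in: "x \<in> X \<Longrightarrow> \<phi> x \<in> X"
    and Aut_orth_iff: "x \<in> X \<Longrightarrow> y \<in> X \<Longrightarrow> R (\<phi> x) (\<phi> y) \<longleftrightarrow> R x y"
    and Aut_eq_iff: "x \<in> X \<Longrightarrow> y \<in> X \<Longrightarrow> \<phi> x = \<phi> y \<longleftrightarrow> x = y"
    and Aut_image: "\<phi> ` X = X"
proof -
  have *: "bij_betw \<phi> X X" "\<And>x y. x \<in> X \<Longrightarrow> y \<in> X \<Longrightarrow> R x y \<longleftrightarrow> R (\<phi> x) (\<phi> y)"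
    using assms unfolding Aut_def orthoset_embedding_def by blast+
  show "R (\<phi> x) (\<phi> y) \<longleftrightarrow> R x y" if "x \<in> X" "y \<in> X" using *(2)[OF that] by (rule sym)
  show "x \<in> X \<Longrightarrow> \<phi> x \<in> X" "x \<in> X \<Longrightarrow> y \<in> X \<Longrightarrow> \<phi> x = \<phi> y \<longleftrightarrow> x = y" "\<phi> ` X = X"
    using *(1) by (auto simp: bij_betw_def inj_on_def)
qed

lemma AutI:
  assumes "bij_betw \<phi> X X" "\<And>x y. x \<in> X \<Longrightarrow> y \<in> X \<Longrightarrow> R (\<phi> x) (\<phi> y) \<longleftrightarrow> R x y"
  shows "\<phi> \<in> Aut X R"
  unfolding Aut_def orthoset_embedding_def
  using assms(1) assms(2)[symmetric] by (auto simp: bij_betw_def)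

lemma Aut_compose:
  assumes "\<phi> \<in> Aut X R" "\<chi> \<in> Aut X R"
  shows "\<chi> \<circ> \<phi> \<in> Aut X R"
proof (rule AutI)
  show "bij_betw (\<chi> \<circ> \<phi>) X X"
    using assms by (auto simp: Aut_def intro: bij_betw_trans)
  show "R ((\<chi> \<circ> \<phi>) x) ((\<chi> \<circ> \<phi>) y) \<longleftrightarrow> R x y" if "x \<in> X" "y \<in> X" for x y
    using AutD[OF assms(1)] AutD[OF assms(2)] that by simp
qed

lemma Aut_image_orthocomp:
  assumes \<phi>: "\<phi> \<in> Aut X R" and A: "A \<subseteq> X"
  shows "\<phi> ` orthocomp X R A = orthocomp X R (\<phi> ` A)"
proof (intro equalityI subsetI)
  fix y assume "y \<in> \<phi> ` orthocomp X R A"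
  then show "y \<in> orthocomp X R (\<phi> ` A)"
    using A AutD[OF \<phi>] by (auto simp: orthocomp_def subset_iff)
next
  fix y assume y: "y \<in> orthocomp X R (\<phi> ` A)"
  then obtain x where "x \<in> X" "y = \<phi> x"
    using Aut_image[OF \<phi>] by (auto simp: orthocomp_def)
  then show "y \<in> \<phi> ` orthocomp X R A"
    using y A AutD[OF \<phi>] by (fastforce simp: orthocomp_def subset_iff)
qed

lemma orthocomp_subset: "orthocomp X R A \<subseteq> X"
  by (auto simp: orthocomp_def)

lemma orthocomp_triple:
  assumes "orthoset X R" "A \<subseteq> X"
  shows "orthocomp X R (orthocomp X R (orthocomp X R A)) = orthocomp X R A"
proof -
  have le: "B \<subseteq> orthocomp X R (orthocomp X R B)" if "B \<subseteq> X" for B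
    using that assms(1) by (auto simp: orthocomp_def orthoset_def symp_on_def)
  have "orthocomp X R C \<subseteq> orthocomp X R B" if "B \<subseteq> C" for B C
    using that by (auto simp: orthocomp_def)
  then show ?thesis using le[OF assms(2)] le[OF orthocomp_subset] by (simp add: subset_antisym)
qed

definition oline :: "'a set \<Rightarrow> ('a \<Rightarrow> 'a \<Rightarrow> bool) \<Rightarrow> 'a \<Rightarrow> 'a \<Rightarrow> 'a set" where
  "oline X R x y = orthocomp X R (orthocomp X R {x, y})"

lemma orthoset_lines_eq: "orthoset_lines X R = {oline X R x y | x y. x \<in> X \<and> y \<in> X \<and> x \<noteq> y}"
  by (simp add: orthoset_lines_def oline_def)

lemma oline_subset: "oline X R x y \<subseteq> X"
  unfolding oline_def by (rule orthocomp_subset)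

lemma oline_endpoints:
  assumes "orthoset X R" "x \<in> X" "y \<in> X"
  shows "x \<in> oline X R x y" "y \<in> oline X R x y"
  using assms by (auto simp: oline_def orthocomp_def orthoset_def symp_on_def)

lemma orthocomp_oline:
  assumes "orthoset X R" "x \<in> X" "y \<in> X"
  shows "orthocomp X R (oline X R x y) = orthocomp X R {x, y}"
  unfolding oline_def using assms by (intro orthocomp_triple) auto

lemma Aut_image_oline:
  assumes "\<phi> \<in> Aut X R" "x \<in> X" "y \<in> X"
  shows "\<phi> ` oline X R x y = oline X R (\<phi> x) (\<phi> y)"
  unfolding oline_def using assms
  by (simp add: Aut_image_orthocomp orthocomp_subset)

text \<open>By \<open>gs\<close> each line is spanned by an orthogonal pair; by \<open>tr\<close>
  such a pair can be moved to another one, one point at a time. An automorphism fixing the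
  complement of a line pointwise maps the double complement, which is the line, to itself.\<close>

lemma line_symmetricI:
  assumes os: "orthoset X R"
    and gs: "\<And>x y. x \<in> X \<Longrightarrow> y \<in> X \<Longrightarrow> x \<noteq> y \<Longrightarrow>
      \<exists>z\<in>X. R x z \<and> orthocomp X R {x, z} = orthocomp X R {x, y}"
    and tr: "\<And>x y. x \<in> X \<Longrightarrow> y \<in> X \<Longrightarrow>
      \<exists>\<phi>\<in>Aut X R. \<phi> x = y \<and> (\<forall>w\<in>X. R w x \<and> R w y \<longrightarrow> \<phi> w = w)"
  shows "line_symmetric X R"
proof -
  have sym: "R x y \<longleftrightarrow> R y x" if "x \<in> X" "y \<in> X" for x y
    using os that by (auto simp: orthoset_def symp_on_def)
  have lines: "\<exists>\<phi>\<in>Aut X R. \<phi> ` l = m" if lm: "l \<in> orthoset_lines X R" "m \<in> orthoset_lines X R" for l m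
  proof -
    have frame: "\<exists>p\<in>X. \<exists>q\<in>X. R p q \<and> k = oline X R p q" if k: "k \<in> orthoset_lines X R" for k
    proof -
      obtain x y where xy: "x \<in> X" "y \<in> X" "x \<noteq> y" "k = oline X R x y"
        using k by (auto simp: orthoset_lines_eq)
      then show ?thesis using gs[of x y] by (metis oline_def)
    qed
    obtain p q where pq: "p \<in> X" "q \<in> X" "R p q" "l = oline X R p q" using frame lm(1) by blast
    obtain p' q' where pq': "p' \<in> X" "q' \<in> X" "R p' q'" "m = oline X R p' q'" using frame lm(2) by blast
    obtain \<phi> where \<phi>: "\<phi> \<in> Aut X R" "\<phi> p = p'" using tr[of p p'] pq pq' by blast
    have q1: "\<phi> q \<in> X" "R p' (\<phi> q)" using AutD[OF \<phi>(1)] \<phi>(2) pq by auto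
    \<comment> \<open>\<open>p'\<close> is orthogonal to both \<open>\<phi> q\<close> and
      \<open>q'\<close>, so the second automorphism does not disturb what the first one
      achieved.\<close>
    obtain \<chi> where \<chi>: "\<chi> \<in> Aut X R" "\<chi> (\<phi> q) = q'" "\<chi> p' = p'"
      using tr[of "\<phi> q" q'] q1 pq' by blast
    have "(\<chi> \<circ> \<phi>) ` l = oline X R (\<chi> (\<phi> p)) (\<chi> (\<phi> q))"
      using Aut_image_oline[OF Aut_compose[OF \<phi>(1) \<chi>(1)]] pq by simp
    then have "(\<chi> \<circ> \<phi>) ` l = m" using \<phi> \<chi> pq' by simp
    then show ?thesis using Aut_compose[OF \<phi>(1) \<chi>(1)] by blast
  qed
  have inv: "\<phi> ` l = l" if l: "l \<in> orthoset_lines X R" and \<phi>: "\<phi> \<in> Aut_rel X R l" for l \<phi>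
  proof -
    obtain x y where xy: "x \<in> X" "y \<in> X" "l = oline X R x y" using l by (auto simp: orthoset_lines_eq)
    have ll: "l = orthocomp X R (orthocomp X R l)"
      using orthocomp_oline[OF os xy(1,2)] xy(3) by (simp add: oline_def)
    have "\<phi> ` orthocomp X R l = orthocomp X R l"
      using \<phi> by (force simp: Aut_rel_def)
    then have "\<phi> ` orthocomp X R (orthocomp X R l) = orthocomp X R (orthocomp X R l)"
      using Aut_image_orthocomp[of \<phi> X R "orthocomp X R l"] \<phi> by (simp add: Aut_rel_def orthocomp_subset)
    then show ?thesis using ll by simp
  qed
  have trans: "\<exists>\<phi>\<in>Aut_rel X R l. \<phi> e = f"
    if l: "l \<in> orthoset_lines X R" and ef: "e \<in> l" "f \<in> l" for l e f
  proof -
    have "l \<subseteq> X" using l oline_subset unfolding orthoset_lines_eq by fastforce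
    then obtain \<phi> where "\<phi> \<in> Aut X R" "\<phi> e = f" "\<forall>w\<in>X. R w e \<and> R w f \<longrightarrow> \<phi> w = w"
      using tr[of e f] ef by blast
    then show ?thesis using ef by (auto simp: Aut_rel_def orthocomp_def)
  qed
  show ?thesis unfolding line_symmetric_def using lines inv trans by blast
qed

section \<open>Line symmetry of Hermitian spaces\<close>

text \<open>The full model: by \<open>surj\<close> every line of the space is a point, and
  \<open>normsq_add\<close> supplies the representatives of equal length on which the reflections
  depend.\<close>

locale herm_model = herm_rep +
  assumes normsq_add: "a \<in> K \<Longrightarrow> b \<in> K \<Longrightarrow> \<exists>c\<in>K. (cmod c)\<^sup>2 = (cmod a)\<^sup>2 + (cmod b)\<^sup>2"
    and surj: "v \<in> vecs n K \<Longrightarrow> v \<noteq> 0 \<Longrightarrow> \<exists>x\<in>X. \<exists>c. v = c \<cdot> \<psi> x"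
begin

lemma ex_rep: "v \<in> V \<Longrightarrow> v \<noteq> 0 \<Longrightarrow> \<exists>x. rep x v"
  unfolding rep_def using surj by blast

lemma normsq_is_norm:
  assumes "v \<in> V"
  shows "\<exists>c\<in>K. normsq n v = (cmod c)\<^sup>2"
proof -
  have "\<exists>c\<in>K. (\<Sum>i<m. (cmod (v i))\<^sup>2) = (cmod c)\<^sup>2" for m
  proof (induction m)
    case 0
    show ?case using zero_in by (intro bexI[of _ 0]) auto
  next
    case (Suc m)
    then obtain c where "c \<in> K" "(\<Sum>i<m. (cmod (v i))\<^sup>2) = (cmod c)\<^sup>2" by blast
    moreover have "v m \<in> K" using assms by (simp add: vecs_def)
    ultimately show ?case using normsq_add[of c "v m"] by (metis sum.lessThan_Suc)
  qed
  then show ?thesis by (simp add: normsq_def)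
qed

text \<open>Both squared lengths are squared moduli of elements \<open>a\<close>, \<open>b\<close>
  of \<open>K\<close>; scaling by \<open>a / b\<close> turns one length into the other without
  leaving \<open>K\<close>.\<close>

lemma rep_normalize:
  assumes "rep x u" "rep y v"
  obtains v' where "rep y v'" "normsq n v' = normsq n u"
proof -
  obtain a b where ab: "a \<in> K" "normsq n u = (cmod a)\<^sup>2" "b \<in> K" "normsq n v = (cmod b)\<^sup>2"
    using normsq_is_norm assms repD(2) by meson
  have "normsq n u \<noteq> 0" "normsq n v \<noteq> 0"
    using assms repD normsq_eq_0_iff by blast+
  then have "a \<noteq> 0" "b \<noteq> 0" using ab by auto
  then have "rep y ((a / b) \<cdot> v)"
    using assms ab by (intro rep_smul divide_in) auto
  moreover have "normsq n ((a / b) \<cdot> v) = normsq n u"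
    using ab \<open>b \<noteq> 0\<close> by (simp add: normsq_smul norm_divide power_divide)
  ultimately show thesis by (rule that)
qed

text \<open>Homogeneity lets \<open>U\<close> act on lines, the inner product carries orthogonality,
  and \<open>U'\<close> gives surjectivity.\<close>

lemma isometry_induces_Aut:
  assumes U: "\<And>v. v \<in> V \<Longrightarrow> U v \<in> V" and U': "\<And>v. v \<in> V \<Longrightarrow> U' v \<in> V"
    and inv: "\<And>v. v \<in> V \<Longrightarrow> U' (U v) = v" "\<And>v. v \<in> V \<Longrightarrow> U (U' v) = v"
    and ip: "\<And>u v. u \<in> V \<Longrightarrow> v \<in> V \<Longrightarrow> U u \<bullet> U v = u \<bullet> v"
    and smul: "\<And>c v. U (c \<cdot> v) = c \<cdot> U v"
  shows "\<exists>\<phi>\<in>Aut X R. \<forall>x v. rep x v \<longrightarrow> rep (\<phi> x) (U v)"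
proof -
  define \<phi> where "\<phi> x = (SOME y. rep y (U (\<psi> x)))" for x
  have nz: "U v \<noteq> 0" if "v \<in> V" "v \<noteq> 0" for v
    using ip[OF that(1) that(1)] herm_self_eq_0_iff[OF that(1)] that(2) by auto
  have \<phi>\<psi>: "rep (\<phi> x) (U (\<psi> x))" if "x \<in> X" for x
    unfolding \<phi>_def using someI_ex[OF ex_rep] U nz \<psi>_vecs \<psi>_nonzero that by blast
  have \<phi>: "rep (\<phi> x) (U v)" if x: "rep x v" for x v
  proof -
    obtain c where "c \<in> K" "c \<noteq> 0" "v = c \<cdot> \<psi> x"
      using rep_proportional[OF rep_\<psi> x] repD(1) x by metis
    then show ?thesis using rep_smul \<phi>\<psi> smul repD(1) x by metis
  qed
  have inj: "x = y" if xy: "x \<in> X" "y \<in> X" "\<phi> x = \<phi> y" for x y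
  proof -
    obtain c where "c \<in> K" "U (\<psi> x) = c \<cdot> U (\<psi> y)"
      using rep_proportional[of "\<phi> x" "U (\<psi> y)" "U (\<psi> x)"] \<phi>\<psi> xy by metis
    then have "U (\<psi> x) = U (c \<cdot> \<psi> y)" by (simp add: smul)
    then have "\<psi> x = c \<cdot> \<psi> y"
      using inv(1) \<psi>_vecs xy vecs_smul \<open>c \<in> K\<close> by metis
    then show ?thesis using \<psi>_inj xy by blast
  qed
  have surj: "\<exists>x\<in>X. \<phi> x = y" if y: "y \<in> X" for y
  proof -
    have "U' (\<psi> y) \<noteq> 0"
      using smul[of 0 0] inv(2) \<psi>_vecs[OF y] \<psi>_nonzero[OF y] by fastforce
    then obtain x where x: "rep x (U' (\<psi> y))" using ex_rep U' \<psi>_vecs y by blast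
    then have "rep (\<phi> x) (\<psi> y)" using \<phi> inv(2) \<psi>_vecs y by fastforce
    then show ?thesis using rep_unique' rep_\<psi> y x repD(1) by blast
  qed
  have "\<phi> \<in> Aut X R"
  proof (rule AutI)
    show "bij_betw \<phi> X X"
      using inj surj repD(1)[OF \<phi>\<psi>] by (force simp: bij_betw_def inj_on_def)
    show "R (\<phi> x) (\<phi> y) \<longleftrightarrow> R x y" if "x \<in> X" "y \<in> X" for x y
      using rep_orth[OF \<phi>\<psi> \<phi>\<psi>] \<psi>_orth ip \<psi>_vecs that by simp
  qed
  then show ?thesis using \<phi> by blast
qed

text \<open>For \<open>normsq u = normsq v\<close>, the map \<open>x \<mapsto> x - (\<langle>x, u - v\<rangle> / \<langle>u, u - v\<rangle>) (u - v)\<close> is a unitary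
  reflection taking \<open>u\<close> to \<open>v\<close>; its inverse is obtained by exchanging \<open>u\<close> and \<open>v\<close>.\<close>

lemma ex_Aut_fixing:
  assumes x: "x \<in> X" and y: "y \<in> X"
  shows "\<exists>\<phi>\<in>Aut X R. \<phi> x = y \<and> (\<forall>w\<in>X. R w x \<and> R w y \<longrightarrow> \<phi> w = w)"
proof -
  define u where "u = \<psi> x"
  have u: "rep x u" using rep_\<psi> x u_def by simp
  obtain v where v: "rep y v" and norm: "normsq n v = normsq n u"
    using rep_normalize[OF u rep_\<psi>[OF y]] .
  define refl where "refl a b z = z - ((z \<bullet> (a - b)) / (a \<bullet> (a - b))) \<cdot> (a - b)" for a b z
  have VV: "u \<in> V" "v \<in> V" using u v repD by auto
  have refl_V: "refl a b z \<in> V" if "a \<in> V" "b \<in> V" "z \<in> V" for a b z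
    unfolding refl_def using that by (intro vecs_in divide_in herm_in)
  \<comment> \<open>The denominators of the reflections do not vanish: otherwise
    \<open>b \<bullet> a\<close> would equal the real number \<open>a \<bullet> a\<close>, and
    \<open>a - b\<close> would have length 0.\<close>
  have nz: "a \<bullet> (a - b) \<noteq> 0" if "a \<in> V" "b \<in> V" "a \<bullet> a = b \<bullet> b" "a \<noteq> b" for a b
  proof
    assume z: "a \<bullet> (a - b) = 0"
    then have "b \<bullet> a = a \<bullet> a" by (metis cnj_herm cnj_herm_self herm_linear(6) right_minus_eq)
    then have "(a - b) \<bullet> (a - b) = 0" using z that(3) by simp
    then show False using herm_self_eq_0_iff[OF vecs_diff[OF that(1,2)]] that(4) by simp
  qed
  have uv: "u \<bullet> u = v \<bullet> v" using norm normsq_eq_iff by metis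
  have inv: "refl b a (refl a b z) = z"
    if "a \<in> V" "b \<in> V" "a \<bullet> a = b \<bullet> b" for a b z
  proof (cases "a = b")
    case False
    define d where "d = a - b"
    have d: "b - a = (-1) \<cdot> d" by (simp add: d_def fun_eq_iff)
    have na: "a \<bullet> d \<noteq> 0" unfolding d_def using nz that False by blast
    have nb: "b \<bullet> d \<noteq> 0" using nz[of b a] that False d by auto
    have dd: "d \<bullet> d = a \<bullet> d - b \<bullet> d" by (simp add: d_def)
    have "refl b a (refl a b z) = z - (z \<bullet> d / a \<bullet> d) \<cdot> d + ((z \<bullet> d - (z \<bullet> d / a \<bullet> d) * (d \<bullet> d)) / b \<bullet> d) \<cdot> d"
      unfolding refl_def d d_def[symmetric]
      by (simp add: fun_eq_iff diff_divide_distrib left_diff_distrib)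
    also have "\<dots> = z"
      unfolding dd using na nb by (simp add: fun_eq_iff field_simps)
    finally show ?thesis .
  qed (simp add: refl_def)
  have ip: "refl u v a \<bullet> refl u v b = a \<bullet> b" for a b
  proof (cases "u = v")
    case False
    define d where "d = u - v"
    have nd: "u \<bullet> d \<noteq> 0" unfolding d_def using nz VV uv False by blast
    \<comment> \<open>Equality of the two lengths enters here; it makes the three correction terms
      in the expanded inner product cancel.\<close>
    have sym: "d \<bullet> d = u \<bullet> d + d \<bullet> u"
      using uv by (simp add: d_def)
    have nd': "d \<bullet> u \<noteq> 0" using nd herm_eq_0_sym by blast
    have "refl u v a \<bullet> refl u v b = a \<bullet> b - (a \<bullet> d) * (d \<bullet> b) / (d \<bullet> u) - (a \<bullet> d) * (d \<bullet> b) / (u \<bullet> d)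
        + (a \<bullet> d) * (d \<bullet> b) * (d \<bullet> d) / ((u \<bullet> d) * (d \<bullet> u))"
      unfolding refl_def d_def[symmetric] using nd nd'
      by (simp add: cnj_herm field_simps)
    also have "\<dots> = a \<bullet> b" unfolding sym using nd nd' by (simp add: field_simps)
    finally show ?thesis .
  qed (simp add: refl_def)
  have smul: "refl u v (c \<cdot> z) = c \<cdot> refl u v z" for c z
    by (simp add: refl_def smul_distrib right_diff_distrib)
  have "\<exists>\<phi>\<in>Aut X R. \<forall>z w. rep z w \<longrightarrow> rep (\<phi> z) (refl u v w)"
    by (rule isometry_induces_Aut[of "refl u v" "refl v u"])
      (use refl_V VV inv uv ip smul in simp_all)
  then obtain \<phi> where \<phi>: "\<phi> \<in> Aut X R" "\<And>z w. rep z w \<Longrightarrow> rep (\<phi> z) (refl u v w)"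
    by blast
  have "refl u v u = v"
    using nz[of u v] VV uv by (cases "u = v") (auto simp: refl_def)
  then have "\<phi> x = y" using \<phi>(2)[OF u] v rep_unique' by simp
  moreover have "\<phi> w = w" if w: "w \<in> X" "R w x" "R w y" for w
  proof -
    have "\<psi> w \<bullet> u = 0" "\<psi> w \<bullet> v = 0" using rep_orth rep_\<psi> u v w by blast+
    then have "refl u v (\<psi> w) = \<psi> w" by (simp add: refl_def)
    then show ?thesis using \<phi>(2)[OF rep_\<psi>] rep_unique' rep_\<psi> w by metis
  qed
  ultimately show ?thesis using \<phi>(1) by blast
qed

text \<open>Gram-Schmidt: replacing \<open>\<psi> y\<close> by its component orthogonal to
  \<open>\<psi> x\<close> does not change the common orthogonal complement.\<close>

lemma ex_orthogonal_in_line: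
  assumes "x \<in> X" "y \<in> X" "x \<noteq> y"
  shows "\<exists>z\<in>X. R x z \<and> orthocomp X R {x, z} = orthocomp X R {x, y}"
proof -
  define w where "w = reject n (\<psi> x) (\<psi> y)"
  have "w \<noteq> 0"
  proof
    assume "w = 0"
    then have "\<psi> y = (\<psi> y \<bullet> \<psi> x / \<psi> x \<bullet> \<psi> x) \<cdot> \<psi> x" by (simp add: w_def reject_def)
    then show False using \<psi>_inj assms by metis
  qed
  then obtain z where z: "rep z w"
    using ex_rep vecs_reject \<psi>_vecs assms unfolding w_def by blast
  have "w \<bullet> \<psi> x = 0" unfolding w_def using herm_reject \<psi>_vecs assms by blast
  then have "R x z" using rep_orth[OF rep_\<psi> z] assms herm_eq_0_sym by blast
  moreover have "R e z \<longleftrightarrow> R e y" if "e \<in> X" "R e x" for e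
    using rep_orth[OF rep_\<psi> z] \<psi>_orth that assms by (simp add: w_def reject_def)
  ultimately show ?thesis using repD(1)[OF z] by (intro bexI[of _ z]) (auto simp: orthocomp_def)
qed

lemma line_symmetric: "line_symmetric X R"
  using orthoset ex_orthogonal_in_line ex_Aut_fixing by (rule line_symmetricI)

lemma unit_vec_in: "k < n \<Longrightarrow> unit_vec k \<in> V"
  by (auto simp: unit_vec_def vecs_def field_in)

lemma unit_vec_nonzero: "unit_vec k \<noteq> 0"
  by (auto simp: unit_vec_def fun_eq_iff)

lemma rank: "orthoset_rank X R = enat n"
proof (rule antisym)
  show "orthoset_rank X R \<le> enat n"
    unfolding orthoset_rank_def
  proof (rule SUP_least)
    fix A assume A: "A \<in> {A. A \<subseteq> X \<and> pairwise R A}"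
    have "finite A"
    proof (rule ccontr)
      assume "infinite A"
      then obtain B where "B \<subseteq> A" "finite B" "card B = Suc n"
        using infinite_arbitrarily_large by blast
      then show False using card_pairwise_orthogonal_le[of B] A pairwise_subset by fastforce
    qed
    then show "(if finite A then enat (card A) else \<infinity>) \<le> enat n"
      using card_pairwise_orthogonal_le A by auto
  qed
next
  define e where "e k = (SOME x. rep x (unit_vec k))" for k
  have e: "rep (e k) (unit_vec k)" if "k < n" for k
    unfolding e_def using someI_ex[OF ex_rep] unit_vec_in unit_vec_nonzero that by blast
  have orth: "R (e k) (e l)" if "k < n" "l < n" "k \<noteq> l" for k l
    using rep_orth[OF e e] herm_unit_vec that by (simp add: unit_vec_def)
  have "inj_on e {..<n}"
    using orth R_irrefl e repD(1) by (metis inj_onI lessThan_iff)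
  then have "card (e ` {..<n}) = n" by (simp add: card_image)
  moreover have "e ` {..<n} \<subseteq> X" "pairwise R (e ` {..<n})"
    using orth repD(1)[OF e] by (auto simp: pairwise_def)
  ultimately show "enat n \<le> orthoset_rank X R"
    unfolding orthoset_rank_def by (intro SUP_upper2[of "e ` {..<n}"]) auto
qed

text \<open>The lines of \<open>unit_vec 0\<close> and \<open>unit_vec 0 + unit_vec 1\<close> are
  distinct and not orthogonal.\<close>

lemma not_boolean:
  assumes "n \<ge> 2"
  shows "\<not> boolean_orthoset X R"
proof
  assume bool: "boolean_orthoset X R"
  have V: "unit_vec 0 \<in> V" "unit_vec 0 + unit_vec 1 \<in> V"
    using assms unit_vec_in vecs_add by auto
  have nz: "unit_vec 0 + unit_vec 1 \<noteq> 0"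
    by (auto simp: unit_vec_def fun_eq_iff)
  obtain x y where x: "rep x (unit_vec 0)" and y: "rep y (unit_vec 0 + unit_vec 1)"
    using ex_rep V nz unit_vec_nonzero by metis
  have unit_vec_apply: "unit_vec k i = (if i = k then 1 else 0)" for k i
    by (simp add: unit_vec_def)
  have "\<not> R x y"
    using rep_orth[OF x y] assms herm_unit_vec[of 0 n "unit_vec 0"] herm_unit_vec[of 0 n "unit_vec 1"]
    by (simp add: unit_vec_apply)
  then have "x = y" using bool x y repD(1) by (auto simp: boolean_orthoset_def pairwise_def)
  then obtain c where "unit_vec 0 + unit_vec 1 = c \<cdot> unit_vec 0"
    using rep_proportional x y by metis
  from fun_cong[OF this, of 1] show False by (simp add: unit_vec_def)
qed

lemma nonboolean_line_symmetric:
  "n \<ge> 2 \<Longrightarrow> nonboolean_line_symmetric_orthoset n X R"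
  unfolding nonboolean_line_symmetric_orthoset_def
  using orthoset not_boolean line_symmetric rank by blast

end

section \<open>Models carried by an arbitrary infinite type\<close>

lemma countable_vecs:
  assumes "countable K"
  shows "countable (vecs n K)"
proof (rule countable_subset)
  show "vecs n K \<subseteq> (\<lambda>xs i. if i < length xs then xs ! i else 0) ` lists K"
  proof
    fix v assume v: "v \<in> vecs n K"
    then have "v = (\<lambda>i. if i < length (map v [0..<n]) then map v [0..<n] ! i else 0)"
      by (auto simp: vecs_def)
    moreover have "map v [0..<n] \<in> lists K" using v by (auto simp: vecs_def)
    ultimately show "v \<in> (\<lambda>xs i. if i < length xs then xs ! i else 0) ` lists K"
      by (rule image_eqI)
  qed
  show "countable ((\<lambda>xs i. if i < length xs then xs ! i else 0) ` lists K)"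
    using assms by (intro countable_image countable_lists)
qed

text \<open>A countable \<open>K\<close> gives countably many lines. One vector is chosen on each of
  them, and the resulting set \<open>P\<close> is copied into the given type by an
  injection.\<close>

lemma ex_herm_model:
  assumes "conj_field K" "countable K" "infinite (UNIV :: 'b set)"
    and norms: "\<And>a b. a \<in> K \<Longrightarrow> b \<in> K \<Longrightarrow> \<exists>c\<in>K. (cmod c)\<^sup>2 = (cmod a)\<^sup>2 + (cmod b)\<^sup>2"
  shows "\<exists>(Y :: 'b set) S \<rho>. herm_model K n Y S \<rho>"
proof -
  define line where "line v = {w \<in> vecs n K. w \<noteq> 0 \<and> (\<exists>c. w = c \<cdot> v)}" for v
  \<comment> \<open>The choice depends only on the set \<open>line v\<close>, so proportional
    vectors share their representative.\<close>
  define pick where "pick v = (SOME w. w \<in> line v)" for v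
  define P where "P = pick ` (vecs n K - {0})"
  have pick: "pick v \<in> line v" if "v \<in> vecs n K - {0}" for v
  proof -
    have "v \<in> line v" using that unfolding line_def by (auto intro: exI[of _ 1])
    then show ?thesis unfolding pick_def by (rule someI[of "\<lambda>w. w \<in> line v"])
  qed
  have line_eq: "line w = line v" if "w = c \<cdot> v" "c \<noteq> 0" for c v w
  proof -
    have "\<exists>a. x = a \<cdot> v" if "x = b \<cdot> w" for x b
      using that \<open>w = c \<cdot> v\<close> by (intro exI[of _ "b * c"]) simp
    moreover have "\<exists>a. x = a \<cdot> w" if "x = b \<cdot> v" for x b
      using that \<open>w = c \<cdot> v\<close> \<open>c \<noteq> 0\<close> by (intro exI[of _ "b / c"]) simp
    ultimately show ?thesis unfolding line_def by blast
  qed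
  have PE: "\<exists>v\<in>vecs n K - {0}. w = pick v" if "w \<in> P" for w
    using that by (auto simp: P_def)
  have "w \<in> vecs n K \<and> w \<noteq> 0" if w: "w \<in> P" for w
  proof -
    obtain v where v: "v \<in> vecs n K - {0}" "w = pick v" using PE[OF w] by blast
    then show ?thesis using pick[OF v(1)] by (simp add: line_def)
  qed
  then have P_sub: "P \<subseteq> vecs n K" "0 \<notin> P" by auto
  have P_unique: "v = w" if "v \<in> P" "w \<in> P" and vw: "v = c \<cdot> w" for v w c
  proof -
    obtain v0 w0 where v0: "v0 \<in> vecs n K - {0}" "v = pick v0" and w0: "w0 \<in> vecs n K - {0}" "w = pick w0"
      using PE[OF \<open>v \<in> P\<close>] PE[OF \<open>w \<in> P\<close>] by blast
    have "\<exists>a. v = a \<cdot> v0" "\<exists>b. w = b \<cdot> w0"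
      using pick[OF v0(1)] pick[OF w0(1)] v0(2) w0(2) by (simp_all add: line_def)
    then obtain a b where a: "v = a \<cdot> v0" and b: "w = b \<cdot> w0" by blast
    have "v \<noteq> 0" "w \<noteq> 0" using \<open>v \<in> P\<close> \<open>w \<in> P\<close> P_sub(2) by auto
    then have nz: "a \<noteq> 0" "b \<noteq> 0" "c \<noteq> 0" using a b vw by auto
    have "line v0 = line w0"
      using line_eq[OF a nz(1)] line_eq[OF b nz(2)] line_eq[OF vw nz(3)] by simp
    then show ?thesis using v0(2) w0(2) by (simp add: pick_def)
  qed
  have "countable P" using countable_vecs[OF assms(2)] countable_subset P_sub(1) by blast
  obtain f :: "nat \<Rightarrow> 'b" where f: "inj f" using infinite_countable_subset[OF assms(3)] by blast
  define g where "g = f \<circ> to_nat_on P"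
  have g: "inj_on g P"
    unfolding g_def
    by (rule comp_inj_on[OF inj_on_to_nat_on[OF \<open>countable P\<close>] inj_on_subset[OF f subset_UNIV]])
  define \<rho> where "\<rho> = inv_into P g"
  have \<rho>_in: "\<rho> y \<in> P" if "y \<in> g ` P" for y unfolding \<rho>_def using that by (rule inv_into_into)
  have \<rho>_g: "\<rho> (g v) = v" if "v \<in> P" for v unfolding \<rho>_def using g that by (rule inv_into_f_f)
  have g_\<rho>: "g (\<rho> y) = y" if "y \<in> g ` P" for y unfolding \<rho>_def using that by (rule f_inv_into_f)
  interpret conj_field K by fact
  have "herm_model K n (g ` P) (\<lambda>x y. herm n (\<rho> x) (\<rho> y) = 0) \<rho>"
  proof unfold_locales
    show "\<rho> x \<in> vecs n K" "\<rho> x \<noteq> 0" if "x \<in> g ` P" for x using \<rho>_in[OF that] P_sub by auto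
    show "x = y" if "x \<in> g ` P" "y \<in> g ` P" "\<rho> x = c \<cdot> \<rho> y" for x y c
      using P_unique[OF \<rho>_in \<rho>_in] g_\<rho> that by metis
    show "\<exists>x\<in>g ` P. \<exists>c. v = c \<cdot> \<rho> x" if v: "v \<in> vecs n K" "v \<noteq> 0" for v
    proof -
      have p: "pick v \<in> P" "pick v \<in> line v" using v pick[of v] by (auto simp: P_def)
      then obtain c where c: "pick v = c \<cdot> v" by (auto simp: line_def)
      have "c \<noteq> 0" using c p P_sub(2) by auto
      then have "v = (1 / c) \<cdot> \<rho> (g (pick v))" using c \<rho>_g[OF p(1)] by simp
      then show ?thesis using p(1) by blast
    qed
  qed (use norms in auto)
  then show ?thesis by blast
qed

section \<open>Line-symmetric orthosets inside Hermitian spaces\<close>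

lemma (in herm_rep) orthogonal_coeffs:
  assumes "A \<bullet> A \<noteq> 0" "B \<bullet> B \<noteq> 0" "C \<bullet> C \<noteq> 0" "A \<bullet> B = 0" "A \<bullet> C = 0" "B \<bullet> C = 0"
    and eq: "a \<cdot> A + b \<cdot> B + c \<cdot> C = a' \<cdot> A + b' \<cdot> B + c' \<cdot> C"
  shows "a = a'" "b = b'" "c = c'"
proof -
  have *: "B \<bullet> A = 0" "C \<bullet> A = 0" "C \<bullet> B = 0" using assms herm_eq_0_sym by blast+
  have "(a \<cdot> A + b \<cdot> B + c \<cdot> C) \<bullet> D = (a' \<cdot> A + b' \<cdot> B + c' \<cdot> C) \<bullet> D" for D using eq by simp
  from this[of A] this[of B] this[of C] show "a = a'" "b = b'" "c = c'" using assms(1-6) * by simp_all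
qed

text \<open>The rank of the orthoset equals the dimension of the surrounding space, so that maximal
  orthogonal families of points are bases.\<close>

locale symmetric_rep = herm_rep +
  assumes nbls: "nonboolean_line_symmetric_orthoset n X R"
    and two_le: "n \<ge> 2"
begin

abbreviation "line \<equiv> oline X R"

text \<open>A finite supremum of a nonempty set in \<open>enat\<close> is a maximum.\<close>

lemma ex_orthogonal_basis:
  obtains A where "A \<subseteq> X" "pairwise R A" "finite A" "card A = n"
proof -
  let ?S = "(\<lambda>A. if finite A then enat (card A) else \<infinity>) ` {A. A \<subseteq> X \<and> pairwise R A}"
  have "Sup ?S = enat n"
    using nbls by (simp add: nonboolean_line_symmetric_orthoset_def orthoset_rank_def)
  moreover have "?S \<noteq> {}" by force
  ultimately have "enat n \<in> ?S"
    unfolding Sup_enat_def by (metis Max_in enat.distinct(1))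
  then show thesis using that by (auto split: if_splits)
qed

lemma line_symmetryD:
  assumes "l \<in> orthoset_lines X R"
  shows "m \<in> orthoset_lines X R \<Longrightarrow> \<exists>\<phi>\<in>Aut X R. \<phi> ` l = m"
    and "\<phi> \<in> Aut_rel X R l \<Longrightarrow> \<phi> ` l = l"
    and "e \<in> l \<Longrightarrow> f \<in> l \<Longrightarrow> \<exists>\<phi>\<in>Aut_rel X R l. \<phi> e = f"
  using nbls assms unfolding nonboolean_line_symmetric_orthoset_def line_symmetric_def by meson+

lemma line_in_lines: "x \<in> X \<Longrightarrow> y \<in> X \<Longrightarrow> x \<noteq> y \<Longrightarrow> line x y \<in> orthoset_lines X R"
  unfolding orthoset_lines_eq by blast

lemma Aut_rel_Aut: "\<phi> \<in> Aut_rel X R l \<Longrightarrow> \<phi> \<in> Aut X R"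
  by (simp add: Aut_rel_def)

text \<open>An automorphism carrying the first line to the second is followed by one that preserves
  the second line and moves the image of \<open>a\<close> to \<open>x\<close>.\<close>

lemma line_homogeneous:
  assumes ab: "a \<in> X" "b \<in> X" "a \<noteq> b" and xy: "x \<in> X" "y \<in> X" "x \<noteq> y"
  obtains \<phi> where "\<phi> \<in> Aut X R" "\<phi> ` line a b = line x y" "\<phi> a = x"
proof -
  note L = line_in_lines[OF ab] line_in_lines[OF xy]
  obtain \<phi> where \<phi>: "\<phi> \<in> Aut X R" "\<phi> ` line a b = line x y"
    using line_symmetryD(1)[OF L] by blast
  have "\<phi> a \<in> line x y"
    using oline_endpoints(1)[OF orthoset ab(1,2)] unfolding \<phi>(2)[symmetric] by (rule imageI)
  then obtain \<chi> where \<chi>: "\<chi> \<in> Aut_rel X R (line x y)" "\<chi> (\<phi> a) = x"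
    using line_symmetryD(3)[OF L(2) _ oline_endpoints(1)[OF orthoset xy(1,2)]] by blast
  have "(\<chi> \<circ> \<phi>) ` line a b = line x y"
    using \<phi>(2) line_symmetryD(2)[OF L(2) \<chi>(1)] by (metis image_comp)
  moreover have "\<chi> \<circ> \<phi> \<in> Aut X R" using \<phi>(1) Aut_rel_Aut[OF \<chi>(1)] by (rule Aut_compose)
  ultimately show thesis using that \<chi>(2) by simp
qed

text \<open>Lines of \<open>X\<close>, defined by double complements inside \<open>X\<close>, lie in
  planes of \<open>K\<^sup>n\<close>. For a line spanned by two members of an orthogonal basis this
  follows from the Fourier expansion; line symmetry transfers it to all lines.\<close>

lemma ex_adapted_point:
  assumes "x \<in> X" "y \<in> X" "x \<noteq> y"
  obtains z where "z \<in> X" "R x z" "z \<in> line x y"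
    "\<And>w. w \<in> line x y \<Longrightarrow> \<psi> w = (\<psi> w \<bullet> \<psi> x / \<psi> x \<bullet> \<psi> x) \<cdot> \<psi> x + (\<psi> w \<bullet> \<psi> z / \<psi> z \<bullet> \<psi> z) \<cdot> \<psi> z"
proof -
  obtain A where A: "A \<subseteq> X" "pairwise R A" "finite A" "card A = n" by (rule ex_orthogonal_basis)
  then obtain a b where ab: "a \<in> A" "b \<in> A" "a \<noteq> b"
    using two_le by (metis card_le_Suc0_iff_eq not_less_eq_eq numeral_2_eq_2)
  obtain \<phi> where \<phi>: "\<phi> \<in> Aut X R" "\<phi> ` line a b = line x y" "\<phi> a = x"
    using line_homogeneous[of a b x y] ab A(1) assms by blast
  have inX: "a \<in> X" "b \<in> X" using ab A(1) by auto
  have inj: "inj_on \<phi> A" using Aut_eq_iff[OF \<phi>(1)] A(1) by (auto intro!: inj_onI)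
  have B: "\<phi> ` A \<subseteq> X" "pairwise R (\<phi> ` A)" "finite (\<phi> ` A)" "card (\<phi> ` A) = n"
    using A Aut_in[OF \<phi>(1)] Aut_orth_iff[OF \<phi>(1)] inj
    by (auto simp: pairwise_def card_image subset_iff)
  show thesis
  proof
    show "\<phi> b \<in> X" using Aut_in[OF \<phi>(1)] ab A(1) by blast
    show "R x (\<phi> b)" using \<phi>(3) Aut_orth_iff[OF \<phi>(1) inX] A(2) ab by (auto simp: pairwise_def)
    show "\<phi> b \<in> line x y" using \<phi>(2) oline_endpoints(2)[OF orthoset inX] by blast
    fix w assume w: "w \<in> line x y"
    have wX: "w \<in> X" using w oline_subset[of X R x y] by blast
    \<comment> \<open>The remaining basis points are orthogonal to \<open>a\<close> and
      \<open>b\<close>, hence to their line, so only two Fourier coefficients survive.\<close>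
    have zero: "\<psi> w \<bullet> \<psi> (\<phi> c) = 0" if c: "c \<in> A - {a, b}" for c
    proof -
      obtain v where v: "v \<in> line a b" "w = \<phi> v" using w \<phi>(2) by blast
      have "c \<in> orthocomp X R {a, b}"
        using c A ab by (auto simp: orthocomp_def pairwise_def)
      then have "R v c" using v(1) by (auto simp: oline_def orthocomp_def)
      then have "R w (\<phi> c)"
        using v Aut_orth_iff[OF \<phi>(1), of v c] oline_subset[of X R a b] c A(1) by auto
      then show ?thesis using \<psi>_orth[OF wX] B(1) c by blast
    qed
    have "\<psi> w = fourier_sum n (\<phi> ` A) \<psi> (\<psi> w)"
      using orthogonal_basis_expansion[OF B] \<psi>_vecs[OF wX] by blast
    also have "\<dots> = (\<Sum>c\<in>A. (\<psi> w \<bullet> \<psi> (\<phi> c) / \<psi> (\<phi> c) \<bullet> \<psi> (\<phi> c)) \<cdot> \<psi> (\<phi> c))"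
      unfolding fourier_sum_def by (simp add: sum.reindex[OF inj])
    also have "\<dots> = (\<Sum>c\<in>{a, b}. (\<psi> w \<bullet> \<psi> (\<phi> c) / \<psi> (\<phi> c) \<bullet> \<psi> (\<phi> c)) \<cdot> \<psi> (\<phi> c))"
      by (rule sum.mono_neutral_right) (use A(3) ab zero in auto)
    finally show "\<psi> w = (\<psi> w \<bullet> \<psi> x / \<psi> x \<bullet> \<psi> x) \<cdot> \<psi> x + (\<psi> w \<bullet> \<psi> (\<phi> b) / \<psi> (\<phi> b) \<bullet> \<psi> (\<phi> b)) \<cdot> \<psi> (\<phi> b)"
      using ab(3) \<phi>(3) by simp
  qed
qed

section \<open>Closure properties of the vectors that represent points\<close>

text \<open>This set need not be a subspace. Its closure under scaling, rejection and certain meets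
  is the substitute for linear structure.\<close>

definition reps :: "(nat \<Rightarrow> complex) set" where
  "reps = {v. v = 0 \<or> (\<exists>x. rep x v)}"

lemma reps_V: "v \<in> reps \<Longrightarrow> v \<in> V"
  using repD(2) vecs_zero by (auto simp: reps_def)

lemma rep_reps: "rep x v \<Longrightarrow> v \<in> reps"
  by (auto simp: reps_def)

lemma repsE: "v \<in> reps \<Longrightarrow> v \<noteq> 0 \<Longrightarrow> \<exists>x. rep x v"
  by (auto simp: reps_def)

lemma reps_smul: "v \<in> reps \<Longrightarrow> c \<cdot> v \<in> V \<Longrightarrow> c \<cdot> v \<in> reps"
proof (cases "c \<cdot> v = 0")
  case False
  assume v: "v \<in> reps" and c: "c \<cdot> v \<in> V"
  have nz: "c \<noteq> 0" "v \<noteq> 0" using False by auto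
  then obtain x where x: "rep x v" using v repsE by blast
  then have "c \<in> K" using smul_vecs_imp_in c repD by blast
  then show ?thesis using rep_smul x nz rep_reps by blast
qed (simp add: reps_def)

text \<open>An adapted point \<open>z\<close> puts \<open>w\<close> into the span of
  \<open>v\<close> and \<open>\<psi> z\<close>, which are orthogonal, so the rejection is a multiple
  of \<open>\<psi> z\<close>.\<close>

lemma reps_reject:
  assumes "v \<in> reps" "w \<in> reps"
  shows "reject n v w \<in> reps"
proof (cases "v = 0 \<or> reject n v w = 0")
  case True
  then show ?thesis using assms by (auto simp: reject_def reps_def)
next
  case False
  then have nz: "v \<noteq> 0" "reject n v w \<noteq> 0" "w \<noteq> 0" by (auto simp: reject_def)
  then obtain x y where xy: "rep x v" "rep y w" using assms repsE by metis
  then have X: "x \<in> X" "y \<in> X" using repD by auto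
  have "x \<noteq> y"
  proof
    assume "x = y"
    then obtain c where "w = c \<cdot> v" using xy rep_proportional by metis
    then show False using nz rep_pos[OF xy(1)] by (simp add: reject_def)
  qed
  then obtain z where z: "z \<in> X" "R x z"
    "\<psi> y = (\<psi> y \<bullet> \<psi> x / \<psi> x \<bullet> \<psi> x) \<cdot> \<psi> x + (\<psi> y \<bullet> \<psi> z / \<psi> z \<bullet> \<psi> z) \<cdot> \<psi> z"
    using ex_adapted_point[OF X] oline_endpoints(2)[OF orthoset X] by metis
  obtain a where a: "\<psi> x = a \<cdot> v" using rep_proportional[OF xy(1) rep_\<psi>[OF X(1)]] .
  obtain b where b: "w = b \<cdot> \<psi> y" using rep_proportional[OF rep_\<psi>[OF X(2)] xy(2)] .
  obtain s t where st: "w = s \<cdot> v + t \<cdot> \<psi> z"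
    using b z(3) a by (metis smul_distrib(1) smul_simps(4))
  have "\<psi> z \<bullet> v = 0"
    using rep_orth[OF xy(1) rep_\<psi>[OF z(1)]] z(2) herm_eq_0_sym by blast
  then have "reject n v w = t \<cdot> \<psi> z"
    using rep_pos[OF xy(1)] by (simp add: reject_def st)
  then show ?thesis
    using reps_smul rep_reps[OF rep_\<psi>[OF z(1)]] vecs_reject repD(2) xy by metis
qed

text \<open>The combination eliminates \<open>C\<close>: it spans the meet of the plane of
  \<open>y\<close>, \<open>y'\<close> with the plane of \<open>A\<close>, \<open>B\<close>. Meets
  are obtained from rejections by duality: inside the span of \<open>A\<close>, \<open>B\<close>,
  \<open>C\<close>, the meet is what is orthogonal to the normals \<open>\<tau>\<close> and
  \<open>C\<close> of the two planes.\<close>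

lemma meet_reps:
  assumes A: "A \<in> reps" "A \<bullet> A \<noteq> 0" and B: "B \<in> reps" "B \<bullet> B \<noteq> 0" and C: "C \<in> reps" "C \<bullet> C \<noteq> 0"
    and orth: "A \<bullet> B = 0" "A \<bullet> C = 0" "B \<bullet> C = 0"
    and y: "y = a \<cdot> A + b \<cdot> B + c \<cdot> C" "y \<in> reps"
    and y': "y' = a' \<cdot> A + b' \<cdot> B + c' \<cdot> C" "y' \<in> reps"
    and K: "c \<in> K" "c' \<in> K"
  shows "c' \<cdot> y - c \<cdot> y' \<in> reps"
proof (cases "c' \<cdot> y - c \<cdot> y' = 0")
  case True
  then show ?thesis by (simp add: reps_def)
next
  case nz: False
  define m where "m = c' \<cdot> y - c \<cdot> y'"
  define ma mb where "ma = c' * a - c * a'" and "mb = c' * b - c * b'"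
  have m: "m = ma \<cdot> A + mb \<cdot> B"
    unfolding m_def y y' ma_def mb_def by (simp add: fun_eq_iff algebra_simps)
  have mV: "m \<in> V" unfolding m_def using reps_V y(2) y'(2) K by (intro vecs_in) auto
  have orth': "B \<bullet> A = 0" "C \<bullet> A = 0" "C \<bullet> B = 0" using orth herm_eq_0_sym by blast+
  \<comment> \<open>A conjugated cross product of \<open>y\<close> and \<open>y'\<close> in the
    basis \<open>A\<close>, \<open>B\<close>, \<open>C\<close>. It serves only to certify that
    \<open>\<tau>\<close> is nonzero.\<close>
  define t where "t = (cnj mb / A \<bullet> A) \<cdot> A - (cnj ma / B \<bullet> B) \<cdot> B + (cnj (a * b' - b * a') / C \<bullet> C) \<cdot> C"
  have At: "A \<bullet> t = mb" "B \<bullet> t = - ma" "C \<bullet> t = a * b' - b * a'"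
    using orth orth' A B C by (simp_all add: t_def)
  have yt: "y \<bullet> t = 0" "y' \<bullet> t = 0"
    unfolding y y' by (simp_all add: At ma_def mb_def algebra_simps)
  \<comment> \<open>\<open>D\<close> lies outside the plane of \<open>y\<close>, \<open>y'\<close>;
    the two rejections below remove its components in that plane, keep \<open>D \<bullet> t\<close>,
    and leave the normal \<open>\<tau>\<close>.\<close>
  obtain D where D: "D = A \<or> D = B" "D \<bullet> t \<noteq> 0"
    using nz m At(1,2) unfolding m_def by fastforce
  define y1 where "y1 = reject n y y'"
  define \<tau> where "\<tau> = reject n y1 (reject n y D)"
  have reps1: "y1 \<in> reps" "reject n y D \<in> reps" "\<tau> \<in> reps"
    unfolding y1_def \<tau>_def using y(2) y'(2) A(1) B(1) D(1) reps_reject by auto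
  have y1y: "y1 \<bullet> y = 0" unfolding y1_def using herm_reject reps_V y(2) by blast
  have \<tau>y1: "\<tau> \<bullet> y1 = 0" unfolding \<tau>_def using herm_reject reps_V reps1 by blast
  have "reject n y D \<bullet> y = 0" using herm_reject reps_V y(2) by blast
  then have \<tau>y: "\<tau> \<bullet> y = 0" unfolding \<tau>_def reject_def[of _ y1] using y1y by simp
  have "y' = y1 + (y' \<bullet> y / y \<bullet> y) \<cdot> y" by (simp add: y1_def reject_def)
  then have \<tau>y': "\<tau> \<bullet> y' = 0" using \<tau>y \<tau>y1 by (metis add_0 herm_linear(5,7) mult_zero_right)
  have \<tau>t: "\<tau> \<bullet> t \<noteq> 0" using yt D(2) by (simp add: \<tau>_def y1_def reject_def)
  define S where "S = {v. \<exists>\<alpha> \<beta> \<gamma>. v = \<alpha> \<cdot> A + \<beta> \<cdot> B + \<gamma> \<cdot> C}"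
  have S_reject: "reject n v w \<in> S" if vw: "v \<in> S" "w \<in> S" for v w
  proof -
    obtain k where k: "reject n v w = w - k \<cdot> v" by (simp add: reject_def)
    obtain \<alpha> \<beta> \<gamma> where v: "v = \<alpha> \<cdot> A + \<beta> \<cdot> B + \<gamma> \<cdot> C" using vw(1) by (auto simp: S_def)
    obtain \<alpha>' \<beta>' \<gamma>' where w: "w = \<alpha>' \<cdot> A + \<beta>' \<cdot> B + \<gamma>' \<cdot> C" using vw(2) by (auto simp: S_def)
    have "w - k \<cdot> v = (\<alpha>' - k * \<alpha>) \<cdot> A + (\<beta>' - k * \<beta>) \<cdot> B + (\<gamma>' - k * \<gamma>) \<cdot> C"
      unfolding v w by (simp add: fun_eq_iff algebra_simps)
    then show ?thesis unfolding S_def k by blast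
  qed
  have "A = 1 \<cdot> A + 0 \<cdot> B + 0 \<cdot> C" "B = 0 \<cdot> A + 1 \<cdot> B + 0 \<cdot> C" by simp_all
  then have "D \<in> S" using D(1) unfolding S_def by blast
  moreover have "y \<in> S" "y' \<in> S" using y y' by (auto simp: S_def)
  ultimately have "\<tau> \<in> S" unfolding \<tau>_def y1_def by (intro S_reject)
  then obtain \<alpha> \<beta> \<gamma> where \<tau>: "\<tau> = \<alpha> \<cdot> A + \<beta> \<cdot> B + \<gamma> \<cdot> C" by (auto simp: S_def)
  \<comment> \<open>The component of \<open>\<tau>\<close> in the plane of \<open>A\<close> and
    \<open>B\<close>. As \<open>m\<close> lies in this plane and is orthogonal to
    \<open>\<tau>\<close>, it is orthogonal to \<open>\<sigma>\<close>.\<close>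
  define \<sigma> where "\<sigma> = \<alpha> \<cdot> A + \<beta> \<cdot> B"
  have "reject n C \<tau> = \<sigma>"
    unfolding reject_def \<tau> \<sigma>_def using orth C by (simp add: fun_eq_iff)
  then have \<sigma>: "\<sigma> \<in> reps" using reps_reject[OF C(1) reps1(3)] by simp
  have "m \<bullet> \<tau> = 0"
    unfolding m_def using \<tau>y \<tau>y' herm_eq_0_sym[of n \<tau>] by simp
  then have m\<tau>: "ma * cnj \<alpha> * (A \<bullet> A) + mb * cnj \<beta> * (B \<bullet> B) = 0"
    unfolding m \<tau> using orth orth' by (simp add: algebra_simps)
  \<comment> \<open>If \<open>\<tau>\<close> were a multiple of \<open>C\<close>, then
    \<open>y\<close> and \<open>y'\<close> would have no \<open>C\<close> component and
    \<open>m\<close> would be 0.\<close>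
  have nz2: "\<alpha> \<noteq> 0 \<or> \<beta> \<noteq> 0"
  proof (rule ccontr)
    assume "\<not> ?thesis"
    then have \<tau>C: "\<tau> = \<gamma> \<cdot> C" using \<tau> by simp
    then have "\<gamma> \<noteq> 0" using \<tau>t by auto
    then have "C \<bullet> y = 0" "C \<bullet> y' = 0" using \<tau>y \<tau>y' \<tau>C by auto
    then have "c = 0" "c' = 0" using orth' C(2) unfolding y y' by auto
    then show False using nz by simp
  qed
  \<comment> \<open>Within the plane, \<open>m\<close> spans the complement of
    \<open>\<sigma>\<close>: that is the line of \<open>B\<close> if \<open>\<sigma>\<close> is a
    multiple of \<open>A\<close>, and otherwise the line of the rejection of \<open>A\<close> from
    \<open>\<sigma>\<close>.\<close>
  show ?thesis
  proof (cases "\<beta> = 0")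
    case True
    then have "ma = 0" using nz2 m\<tau> A(2) by simp
    then have "m = mb \<cdot> B" using m by simp
    then show ?thesis using reps_smul[OF B(1), of mb] mV unfolding m_def by simp
  next
    case False
    define N where "N = \<sigma> \<bullet> \<sigma>"
    have N: "N = \<alpha> * cnj \<alpha> * (A \<bullet> A) + \<beta> * cnj \<beta> * (B \<bullet> B)"
      unfolding N_def \<sigma>_def using orth orth' by (simp add: algebra_simps)
    have "N \<noteq> 0"
    proof
      assume "N = 0"
      then have "\<sigma> = 0" using herm_self_eq_0_iff reps_V \<sigma> unfolding N_def by blast
      then have "\<sigma> \<bullet> B = 0" by simp
      then show False using False orth B(2) unfolding \<sigma>_def by simp
    qed
    have "reject n \<sigma> A = A - (cnj \<alpha> * (A \<bullet> A) / N) \<cdot> \<sigma>"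
      unfolding reject_def N_def[symmetric] by (simp add: \<sigma>_def orth)
    then have \<zeta>: "reject n \<sigma> A = (\<beta> / N) \<cdot> ((cnj \<beta> * (B \<bullet> B)) \<cdot> A - (cnj \<alpha> * (A \<bullet> A)) \<cdot> B)"
      using \<open>N \<noteq> 0\<close> unfolding \<sigma>_def by (simp add: fun_eq_iff field_simps) (simp add: N algebra_simps)
    have mb: "mb = - (ma * cnj \<alpha> * (A \<bullet> A)) / (cnj \<beta> * (B \<bullet> B))"
      using m\<tau> False B(2) by (simp add: field_simps add_eq_0_iff)
    have "m = (ma / (cnj \<beta> * (B \<bullet> B)) * (N / \<beta>)) \<cdot> reject n \<sigma> A"
      unfolding m mb \<zeta> using False B(2) \<open>N \<noteq> 0\<close> by (simp add: fun_eq_iff field_simps)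
    then show ?thesis
      using reps_smul[OF reps_reject[OF \<sigma> A(1)]] mV unfolding m_def by metis
  qed
qed

section \<open>Lines and automorphisms in coordinates\<close>

lemma rep_unscale:
  assumes "rep x (c \<cdot> v)" "v \<in> V"
  shows "rep x v"
proof -
  have nz: "c \<noteq> 0" "v \<noteq> 0" using repD(3)[OF assms(1)] by auto
  then have "c \<in> K" using smul_vecs_imp_in repD(2)[OF assms(1)] assms(2) by blast
  then have "rep x ((1 / c) \<cdot> c \<cdot> v)"
    using rep_smul[OF assms(1) divide_in[OF one_in \<open>c \<in> K\<close>]] nz by simp
  then show ?thesis using nz by simp
qed

lemma in_lineI:
  assumes "rep x u" "rep y v" "rep z (a \<cdot> u + b \<cdot> v)"
  shows "z \<in> line x y"
proof -
  have "R z w" if "w \<in> orthocomp X R {x, y}" for w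
  proof -
    have w: "w \<in> X" "R w x" "R w y" using that by (auto simp: orthocomp_def)
    then have "\<psi> w \<bullet> u = 0" "\<psi> w \<bullet> v = 0" using rep_orth[OF rep_\<psi>] assms by blast+
    then have "R w z" using rep_orth[OF rep_\<psi>[OF w(1)] assms(3)] by simp
    then show ?thesis using R_sym w(1) repD(1)[OF assms(3)] by blast
  qed
  then show ?thesis using repD(1)[OF assms(3)] by (auto simp: oline_def orthocomp_def)
qed

text \<open>An adapted point \<open>t\<close> expresses \<open>v\<close> and \<open>w\<close>
  through \<open>u\<close> and \<open>\<psi> t\<close>. Since \<open>x \<noteq> y\<close>, the
  coefficient of \<open>\<psi> t\<close> in \<open>v\<close> is nonzero, so \<open>\<psi> t\<close>
  can be eliminated.\<close>

lemma in_lineE: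
  assumes x: "rep x u" and y: "rep y v" and "x \<noteq> y" and z: "z \<in> line x y" "rep z w"
  obtains a b where "a \<in> K" "b \<in> K" "w = a \<cdot> u + b \<cdot> v"
proof -
  have X: "x \<in> X" "y \<in> X" using x y repD by auto
  obtain t where t: "t \<in> X"
    "\<And>w. w \<in> line x y \<Longrightarrow> \<psi> w = (\<psi> w \<bullet> \<psi> x / \<psi> x \<bullet> \<psi> x) \<cdot> \<psi> x + (\<psi> w \<bullet> \<psi> t / \<psi> t \<bullet> \<psi> t) \<cdot> \<psi> t"
    using ex_adapted_point[OF X \<open>x \<noteq> y\<close>] by metis
  obtain p where p: "p \<in> K" "\<psi> x = p \<cdot> u" using rep_proportional[OF x rep_\<psi>[OF X(1)]] .
  have expand: "\<exists>a\<in>K. \<exists>b\<in>K. w' = a \<cdot> u + b \<cdot> \<psi> t" if w': "z' \<in> line x y" "rep z' w'" for z' w'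
  proof -
    have zX: "z' \<in> X" using repD(1)[OF w'(2)] .
    obtain r where r: "r \<in> K" "w' = r \<cdot> \<psi> z'" using rep_proportional[OF rep_\<psi>[OF zX] w'(2)] .
    define a b where "a = \<psi> z' \<bullet> \<psi> x / \<psi> x \<bullet> \<psi> x" and "b = \<psi> z' \<bullet> \<psi> t / \<psi> t \<bullet> \<psi> t"
    have "a \<in> K" "b \<in> K"
      unfolding a_def b_def using \<psi>_vecs zX X t(1) by (auto intro!: divide_in herm_in)
    have "\<psi> z' = a \<cdot> p \<cdot> u + b \<cdot> \<psi> t"
      using t(2)[OF w'(1)] unfolding a_def[symmetric] b_def[symmetric] by (simp add: p(2))
    then have "w' = (r * a * p) \<cdot> u + (r * b) \<cdot> \<psi> t"
      unfolding r(2) by (simp add: smul_distrib mult.assoc)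
    moreover have "r * a * p \<in> K" "r * b \<in> K"
      using r(1) p(1) \<open>a \<in> K\<close> \<open>b \<in> K\<close> mult_in by auto
    ultimately show ?thesis by blast
  qed
  obtain a b where v: "a \<in> K" "b \<in> K" "v = a \<cdot> u + b \<cdot> \<psi> t"
    using expand[OF oline_endpoints(2)[OF orthoset X] y] by blast
  obtain c d where w: "c \<in> K" "d \<in> K" "w = c \<cdot> u + d \<cdot> \<psi> t" using expand[OF z] by blast
  have "b \<noteq> 0"
  proof
    assume "b = 0"
    then have "v = a \<cdot> u" using v by simp
    then show False using rep_unique x y \<open>x \<noteq> y\<close> by metis
  qed
  then have "w = (c - d * a / b) \<cdot> u + (d / b) \<cdot> v"
    unfolding v w by (simp add: fun_eq_iff field_simps)
  moreover have "c - d * a / b \<in> K" "d / b \<in> K" using v w by (auto intro!: field_in)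
  ultimately show thesis by (rule that[rotated 2])
qed

text \<open>Automorphisms preserve lines, so linear relations persist with unknown coefficients. The
  coefficients are recovered later by representing one image point in two ways.\<close>

lemma rep_Aut_line:
  assumes \<phi>: "\<phi> \<in> Aut X R" and x: "rep x u" and y: "rep y v" and z: "rep z (a \<cdot> u + b \<cdot> v)"
    and x': "rep (\<phi> x) u'" and y': "rep (\<phi> y) v'"
  obtains a' b' where "rep (\<phi> z) (a' \<cdot> u' + b' \<cdot> v')"
proof (cases "x = y")
  case True
  obtain c where "v = c \<cdot> u" using rep_proportional x y True by metis
  then have "a \<cdot> u + b \<cdot> v = (a + b * c) \<cdot> u" by (simp add: fun_eq_iff algebra_simps)
  then have "z = x" using rep_unique x z by metis
  then have "rep (\<phi> z) (1 \<cdot> u' + 0 \<cdot> v')" using x' by simp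
  then show thesis by (rule that)
next
  case False
  have X: "x \<in> X" "y \<in> X" "z \<in> X" using x y z repD by auto
  have "\<phi> z \<in> line (\<phi> x) (\<phi> y)"
    using in_lineI[OF x y z] Aut_image_oline[OF \<phi> X(1,2)] by blast
  moreover have "\<phi> x \<noteq> \<phi> y" using Aut_eq_iff[OF \<phi> X(1,2)] False by simp
  moreover have z': "rep (\<phi> z) (\<psi> (\<phi> z))" using rep_\<psi> Aut_in[OF \<phi> X(3)] .
  ultimately obtain a' b' where "\<psi> (\<phi> z) = a' \<cdot> u' + b' \<cdot> v'"
    using in_lineE[OF x' y'] by metis
  then show thesis using that z' by metis
qed

text \<open>Line symmetry brings two distinct non-orthogonal points onto the line; they cannot both
  belong to the orthogonal pair \<open>e\<close>, \<open>f\<close>.\<close>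

lemma ex_third_point:
  assumes "e \<in> X" "f \<in> X" "R e f"
  obtains z where "z \<in> line e f" "z \<noteq> e" "z \<noteq> f"
proof -
  have ef: "e \<noteq> f" using R_irrefl assms by blast
  obtain x y where xy: "x \<in> X" "y \<in> X" "x \<noteq> y" "\<not> R x y"
    using nbls by (auto simp: nonboolean_line_symmetric_orthoset_def boolean_orthoset_def pairwise_def)
  obtain \<phi> where \<phi>: "\<phi> \<in> Aut X R" "\<phi> ` line x y = line e f"
    using line_symmetryD(1)[OF line_in_lines[OF xy(1-3)] line_in_lines[OF assms(1,2) ef]] by blast
  have "\<phi> x \<in> line e f" "\<phi> y \<in> line e f"
    using \<phi>(2) oline_endpoints[OF orthoset xy(1,2)] by blast+
  moreover have "\<not> R (\<phi> x) (\<phi> y)" "\<phi> x \<noteq> \<phi> y"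
    using Aut_orth_iff[OF \<phi>(1) xy(1,2)] Aut_eq_iff[OF \<phi>(1) xy(1,2)] xy by auto
  ultimately show thesis using that assms R_sym by metis
qed

text \<open>A third point on a line fixes the relative scale of the representatives of the other
  two; rescaling that of \<open>e\<close> absorbs both coefficients.\<close>

lemma third_point_rep:
  assumes e: "e \<in> X" and f: "rep f v" and "e \<noteq> f" and z: "z \<in> line e f" "z \<noteq> e" "z \<noteq> f"
  obtains u where "rep e u" "rep z (u + v)"
proof -
  have zX: "z \<in> X" using z(1) oline_subset[of X R e f] by blast
  obtain a b where ab: "a \<in> K" "b \<in> K" "\<psi> z = a \<cdot> \<psi> e + b \<cdot> v"
    using in_lineE[OF rep_\<psi>[OF e] f \<open>e \<noteq> f\<close> z(1) rep_\<psi>[OF zX]] .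
  have "b \<noteq> 0"
  proof
    assume "b = 0"
    then have "\<psi> z = a \<cdot> \<psi> e" using ab by simp
    then show False using \<psi>_inj[OF zX e] z(2) by blast
  qed
  have "a \<noteq> 0"
  proof
    assume "a = 0"
    then have "\<psi> z = b \<cdot> v" using ab by simp
    then show False using rep_unique[OF f] rep_\<psi>[OF zX] z(3) by metis
  qed
  have e': "rep e ((a / b) \<cdot> \<psi> e)"
    using \<open>a \<noteq> 0\<close> \<open>b \<noteq> 0\<close> ab(1,2) e by (intro rep_smul rep_\<psi> field_in) auto
  have "\<psi> z = b \<cdot> ((a / b) \<cdot> \<psi> e + v)"
    unfolding ab using \<open>b \<noteq> 0\<close> by (simp add: smul_distrib)
  then have "rep z ((a / b) \<cdot> \<psi> e + v)"
    using rep_unscale rep_\<psi>[OF zX] vecs_add repD(2)[OF e'] repD(2)[OF f] by metis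
  with e' show thesis by (rule that)
qed

text \<open>An automorphism fixing every point of the line through \<open>v\<^sub>3\<close> and \<open>v\<^sub>4\<close> behaves like a linear map:
  as the scalar \<open>\<kappa>\<close> can be read off the fixed point \<open>[\<kappa> v\<^sub>4 - v\<^sub>3]\<close>, it cannot be twisted by a
  field automorphism.\<close>

lemma Aut_scalar_transport:
  assumes \<phi>: "\<phi> \<in> Aut X R" and fixed: "\<forall>z a b. rep z (a \<cdot> v3 + b \<cdot> v4) \<longrightarrow> \<phi> z = z"
    and e3: "rep e3 v3" and e4: "rep e4 v4" and q: "rep q (v3 - v4)" and e: "rep e u" and e': "rep (\<phi> e) w"
    and orth: "v3 \<bullet> v4 = 0" "u \<bullet> v3 = 0" "u \<bullet> v4 = 0" "w \<bullet> v3 = 0" "w \<bullet> v4 = 0"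
    and P: "rep P (u + v3)" and P': "rep (\<phi> P) (w + v3)" and Q: "rep Q (\<kappa> \<cdot> u + v3)"
  shows "rep (\<phi> Q) (\<kappa> \<cdot> w + v3)"
proof -
  have orth': "v4 \<bullet> v3 = 0" "v3 \<bullet> u = 0" "v4 \<bullet> u = 0" "v3 \<bullet> w = 0" "v4 \<bullet> w = 0"
    using orth herm_eq_0_sym by blast+
  note pos = rep_pos[OF e3] rep_pos[OF e4] rep_pos[OF e] rep_pos[OF e']
  note reps = rep_reps[OF e3] rep_reps[OF e4] rep_reps[OF e] rep_reps[OF P] rep_reps[OF q] rep_reps[OF Q]
  have fix34: "\<phi> e3 = e3" "\<phi> e4 = e4" "\<phi> q = q"
    using fixed[rule_format, of e3 1 0] fixed[rule_format, of e4 0 1] fixed[rule_format, of q 1 "-1"] e3 e4 q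
    by (simp_all add: smul_def plus_fun_def fun_diff_def)
  have "(\<kappa> \<cdot> u + v3) - v3 \<in> V" using repD(2)[OF Q] repD(2)[OF e3] by (rule vecs_diff)
  then have K: "\<kappa> \<in> K" using smul_vecs_imp_in repD(2,3)[OF e] by simp
  \<comment> \<open>\<open>[u + v4]\<close> is the meet of the line through \<open>P\<close> and
    \<open>q\<close> with the line through \<open>e\<close> and \<open>e4\<close>.\<close>
  have "1 \<cdot> (u + v3) - 1 \<cdot> (v3 - v4) \<in> reps"
    by (rule meet_reps[where A = u and B = v4 and C = v3 and a = 1 and b = 0 and a' = 0 and b' = "-1"])
      (use reps pos orth orth' in \<open>auto simp: fun_eq_iff one_in\<close>)
  then have "u + v4 \<in> reps" by simp
  moreover have "u + v4 \<noteq> 0"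
  proof
    assume "u + v4 = 0"
    then have "(u + v4) \<bullet> v4 = 0" by simp
    then show False using orth pos by simp
  qed
  ultimately obtain P4 where P4: "rep P4 (u + v4)" using repsE by blast
  \<comment> \<open>As \<open>q\<close> and \<open>e4\<close> are fixed, \<open>\<phi> P4\<close> is
    on the line through \<open>\<phi> P\<close> and \<open>q\<close> and on the line through
    \<open>\<phi> e\<close> and \<open>e4\<close>; comparing the \<open>v3\<close> components
    singles out \<open>[w + v4]\<close>.\<close>
  have P4': "rep (\<phi> P4) (w + v4)"
  proof -
    have "u + v4 = 1 \<cdot> (u + v3) + (-1) \<cdot> (v3 - v4)" by (simp add: fun_eq_iff)
    then obtain a b where ab: "rep (\<phi> P4) (a \<cdot> (w + v3) + b \<cdot> (v3 - v4))"
      using rep_Aut_line[OF \<phi> P q _ P'] P4 q fix34 by metis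
    have "u + v4 = 1 \<cdot> u + 1 \<cdot> v4" by simp
    then obtain a' b' where ab': "rep (\<phi> P4) (a' \<cdot> w + b' \<cdot> v4)"
      using rep_Aut_line[OF \<phi> e e4 _ e'] P4 e4 fix34 by metis
    obtain k where k: "k \<noteq> 0" "a \<cdot> (w + v3) + b \<cdot> (v3 - v4) = k \<cdot> (a' \<cdot> w + b' \<cdot> v4)"
      using rep_proportional[OF ab' ab] .
    from arg_cong[OF k(2), of "\<lambda>v. v \<bullet> v3"] have "a + b = 0"
      using pos orth orth' by (simp flip: distrib_right)
    then have "b = - a" by (simp add: add_eq_0_iff)
    then have v: "a \<cdot> (w + v3) + b \<cdot> (v3 - v4) = a \<cdot> (w + v4)" by (simp add: fun_eq_iff algebra_simps)
    have "w + v4 \<in> V" using repD(2) e' e4 vecs_add by blast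
    then show ?thesis using rep_unscale ab v by metis
  qed
  \<comment> \<open>The line through \<open>P4\<close> and \<open>Q\<close> meets the line through
    \<open>e3\<close> and \<open>e4\<close> in the point \<open>r = [\<kappa> v4 - v3]\<close>,
    which \<open>\<phi>\<close> fixes.\<close>
  have "\<kappa> \<cdot> (u + v4) - 1 \<cdot> (\<kappa> \<cdot> u + v3) \<in> reps"
    by (rule meet_reps[where A = v4 and B = v3 and C = u and a = 1 and b = 0 and a' = 0 and b' = 1])
      (use reps rep_reps[OF P4] pos orth orth' K in \<open>auto simp: fun_eq_iff one_in\<close>)
  moreover have "\<kappa> \<cdot> (u + v4) - 1 \<cdot> (\<kappa> \<cdot> u + v3) = (-1) \<cdot> v3 + \<kappa> \<cdot> v4"
    by (simp add: fun_eq_iff algebra_simps)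
  moreover have "(-1) \<cdot> v3 + \<kappa> \<cdot> v4 \<noteq> 0"
  proof
    assume "(-1) \<cdot> v3 + \<kappa> \<cdot> v4 = 0"
    then have "((-1) \<cdot> v3 + \<kappa> \<cdot> v4) \<bullet> v3 = 0" by simp
    then show False using orth' pos by simp
  qed
  ultimately obtain r where r: "rep r ((-1) \<cdot> v3 + \<kappa> \<cdot> v4)" using repsE by metis
  obtain a b where ab: "rep (\<phi> Q) (a \<cdot> w + b \<cdot> v3)"
    using rep_Aut_line[OF \<phi> e e3, of Q \<kappa> 1, OF _ e'] Q e3 fix34 by (metis smul_simps(1))
  have "(-1) \<cdot> v3 + \<kappa> \<cdot> v4 = \<kappa> \<cdot> (u + v4) + (-1) \<cdot> (\<kappa> \<cdot> u + v3)"
    by (simp add: fun_eq_iff algebra_simps)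
  then obtain x y where xy: "rep (\<phi> r) (x \<cdot> (w + v4) + y \<cdot> (a \<cdot> w + b \<cdot> v3))"
    using rep_Aut_line[OF \<phi> P4 Q _ P4' ab] r by metis
  \<comment> \<open>\<open>r = \<phi> r\<close> also lies on the line through the images of
    \<open>P4\<close> and \<open>Q\<close>; its three coordinates determine the ratio of
    \<open>a\<close> to \<open>b\<close>.\<close>
  obtain k where k: "k \<noteq> 0" "x \<cdot> (w + v4) + y \<cdot> (a \<cdot> w + b \<cdot> v3) = k \<cdot> ((-1) \<cdot> v3 + \<kappa> \<cdot> v4)"
    using rep_proportional[OF r] xy fixed r by metis
  from arg_cong[OF k(2), of "\<lambda>v. v \<bullet> v4"] have c4: "x = k * \<kappa>"
    using pos orth orth' by simp
  from arg_cong[OF k(2), of "\<lambda>v. v \<bullet> v3"] have c3: "y * b = - k"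
    using pos orth orth' by (simp add: minus_mult_left del: mult_minus_left)
  from arg_cong[OF k(2), of "\<lambda>v. v \<bullet> w"] have cw: "x + y * a = 0"
    using pos orth orth' by (simp flip: distrib_right mult.assoc)
  have nz: "y \<noteq> 0" "b \<noteq> 0" using c3 k(1) by auto
  have "y * a = y * (b * \<kappa>)" using c4 c3 cw by (simp add: algebra_simps add_eq_0_iff)
  then have "a = b * \<kappa>" using nz by simp
  then have v: "a \<cdot> w + b \<cdot> v3 = b \<cdot> (\<kappa> \<cdot> w + v3)" by (simp add: fun_eq_iff algebra_simps)
  have wV: "\<kappa> \<cdot> w + v3 \<in> V" using repD(2) e' e3 K vecs_add vecs_smul by blast
  then show ?thesis using rep_unscale ab v by metis
qed

text \<open>The scalar \<open>\<kappa>\<close> is chosen such that \<open>[\<kappa> u + v3]\<close>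
  is orthogonal to \<open>[u + v3]\<close>. The image points are \<open>[\<kappa> w + v3]\<close>
  and \<open>[w + v3]\<close> with the same \<open>\<kappa>\<close>, and their orthogonality says
  that \<open>w\<close> is as long as \<open>u\<close>.\<close>

lemma Aut_norm_preserving:
  assumes \<phi>: "\<phi> \<in> Aut X R" and fixed: "\<forall>z a b. rep z (a \<cdot> v3 + b \<cdot> v4) \<longrightarrow> \<phi> z = z"
    and e3: "rep e3 v3" and e4: "rep e4 v4" and q: "rep q (v3 - v4)" and e: "rep e u" and e': "rep (\<phi> e) w"
    and orth: "v3 \<bullet> v4 = 0" "u \<bullet> v3 = 0" "u \<bullet> v4 = 0" "w \<bullet> v3 = 0" "w \<bullet> v4 = 0"
    and P: "rep P (u + v3)" and P': "rep (\<phi> P) (w + v3)"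
  shows "w \<bullet> w = u \<bullet> u"
proof -
  note pos = rep_pos[OF e3] rep_pos[OF e] rep_pos[OF P]
  have orth': "v3 \<bullet> u = 0" "v3 \<bullet> w = 0" using orth herm_eq_0_sym by blast+
  define \<kappa> where "\<kappa> = - (v3 \<bullet> v3) / (u \<bullet> u)"
  have "\<kappa> \<in> K" unfolding \<kappa>_def using repD(2) e e3 by (intro divide_in minus_in herm_in) blast+
  then have QV: "\<kappa> \<cdot> u + v3 \<in> V" using repD(2) e e3 vecs_add vecs_smul by blast
  have P2: "(u + v3) \<bullet> (u + v3) = u \<bullet> u + v3 \<bullet> v3" using orth orth' by simp
  then have nz: "u \<bullet> u + v3 \<bullet> v3 \<noteq> 0" using rep_pos[OF P] by metis
  \<comment> \<open>This shows that \<open>[\<kappa> u + v3]\<close> is a point of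
    \<open>X\<close>.\<close>
  have "reject n (u + v3) u = (- (u \<bullet> u) / (u \<bullet> u + v3 \<bullet> v3)) \<cdot> (\<kappa> \<cdot> u + v3)"
  proof -
    have "a - U / (U + T) * (a + b) = - U / (U + T) * (- T / U * a + b)"
      if "U \<noteq> 0" "U + T \<noteq> 0" for a b U T :: complex
      using that by (simp add: divide_simps) (simp add: algebra_simps)
    from this[OF pos(2) nz] show ?thesis
      unfolding reject_def P2 \<kappa>_def using orth by (simp add: fun_eq_iff)
  qed
  moreover have "(- (u \<bullet> u + v3 \<bullet> v3) / u \<bullet> u) * (- (u \<bullet> u) / (u \<bullet> u + v3 \<bullet> v3)) = 1"
    using nz pos(2) by (simp add: divide_simps)
  ultimately have "\<kappa> \<cdot> u + v3 = (- (u \<bullet> u + v3 \<bullet> v3) / (u \<bullet> u)) \<cdot> reject n (u + v3) u"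
    by (metis smul_simps(1,4))
  then have "\<kappa> \<cdot> u + v3 \<in> reps"
    using reps_smul[OF reps_reject[OF rep_reps[OF P] rep_reps[OF e]]] QV by metis
  moreover have "\<kappa> \<cdot> u + v3 \<noteq> 0"
  proof
    assume "\<kappa> \<cdot> u + v3 = 0"
    then have "(\<kappa> \<cdot> u + v3) \<bullet> v3 = 0" by simp
    then show False using orth pos by simp
  qed
  ultimately obtain Q where Q: "rep Q (\<kappa> \<cdot> u + v3)" using repsE by blast
  have "R Q P" using rep_orth[OF Q P] pos orth orth' by (simp add: \<kappa>_def)
  then have "R (\<phi> Q) (\<phi> P)" using Aut_orth_iff[OF \<phi>] repD(1) Q P by blast
  then have "(\<kappa> \<cdot> w + v3) \<bullet> (w + v3) = 0"
    using rep_orth[OF Aut_scalar_transport[OF \<phi> fixed e3 e4 q e e' orth P P' Q] P'] by simp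
  then have "\<kappa> * (w \<bullet> w) + v3 \<bullet> v3 = 0" using orth orth' by simp
  then show ?thesis using pos by (simp add: \<kappa>_def field_simps)
qed

text \<open>Representatives with a common nonzero component along \<open>w\<close> can only be
  proportional with factor 1, so equality of points becomes equality of vectors.\<close>

lemma rep_coeff_unique:
  assumes x: "rep x u" and y: "rep y v" and zero: "u \<bullet> w = v \<bullet> w" "v \<bullet> w \<noteq> 0"
  shows "x = y \<longleftrightarrow> u = v"
proof
  assume "x = y"
  then obtain c where "u = c \<cdot> v" using rep_proportional x y by metis
  then show "u = v" using zero by simp
qed (use rep_unique' x y in blast)

lemma Aut_rel_line_fixes:
  assumes "\<phi> \<in> Aut_rel X R (line x y)" "x \<in> X" "y \<in> X" "z \<in> X" "R z x" "R z y"
  shows "\<phi> z = z"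
proof -
  have "z \<in> orthocomp X R (line x y)"
    unfolding orthocomp_oline[OF orthoset assms(2,3)] using assms by (auto simp: orthocomp_def)
  then show ?thesis using assms(1) by (simp add: Aut_rel_def)
qed

lemma Aut_third_point_rep:
  assumes \<phi>: "\<phi> \<in> Aut X R" "\<phi> f = f" and e: "e \<in> X" and f: "rep f v" and "e \<noteq> f"
    and z: "z \<in> line e f" "z \<noteq> e" "z \<noteq> f"
  obtains w where "rep (\<phi> e) w" "rep (\<phi> z) (w + v)"
proof -
  have X: "f \<in> X" "z \<in> X" using repD(1)[OF f] z(1) oline_subset[of X R e f] by auto
  have "\<phi> z \<in> line (\<phi> e) f"
    using imageI[OF z(1), of \<phi>] Aut_image_oline[OF \<phi>(1) e X(1)] \<phi>(2) by simp
  moreover have "\<phi> e \<noteq> f" "\<phi> z \<noteq> \<phi> e" "\<phi> z \<noteq> f"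
    using Aut_eq_iff[OF \<phi>(1) e X(1)] Aut_eq_iff[OF \<phi>(1) X(2) e] Aut_eq_iff[OF \<phi>(1) X(2,1)]
      z \<open>e \<noteq> f\<close> \<phi>(2) by simp_all
  ultimately show thesis
    using third_point_rep[OF Aut_in[OF \<phi>(1) e] f] that by metis
qed

text \<open>In coordinates, \<open>\<beta>\<close> takes \<open>v\<^sub>1\<close> to \<open>v\<^sub>2\<close>, and \<open>\<alpha>\<close> takes \<open>v\<^sub>1\<close> to \<open>s (v\<^sub>1 + v\<^sub>2)\<close> and \<open>v\<^sub>2\<close> to
  \<open>t (v\<^sub>1 - v\<^sub>2)\<close>, whence \<open>\<alpha>\<^sup>2 v\<^sub>1 = (s\<^sup>2 + s t) v\<^sub>1 + (s\<^sup>2 - s t) v\<^sub>2\<close>. The point \<open>p = [v\<^sub>1 + v\<^sub>3]\<close> keeps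
  track of the scaling.\<close>

lemma rotation_coordinates:
  assumes e: "e1 \<in> X" "e2 \<in> X" "e3 \<in> X" "e4 \<in> X"
    and perp: "R e1 e2" "R e1 e3" "R e1 e4" "R e2 e3" "R e2 e4" "R e3 e4"
    and p: "p \<in> line e1 e3" "p \<noteq> e1" "p \<noteq> e3"
    and q: "q \<in> line e4 e3" "q \<noteq> e4" "q \<noteq> e3"
    and \<beta>: "\<beta> \<in> Aut_rel X R (line e1 e2)" "\<beta> e1 = e2"
    and g: "g \<in> line e1 e2" "g \<in> line p (\<beta> p)"
    and h: "h \<in> line e1 e2" "R g h"
    and \<alpha>: "\<alpha> \<in> Aut_rel X R (line e1 e2)" "\<alpha> e1 = h"
  shows "\<exists>s\<in>K. \<exists>t\<in>K. 2 * (s * cnj s) = 1 \<and> 2 * (t * cnj t) = 1 \<and>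
    (\<alpha> (\<alpha> p) = p \<longleftrightarrow> s\<^sup>2 + s * t = 1 \<and> s\<^sup>2 - s * t = 0) \<and>
    (\<alpha> (\<alpha> p) = \<beta> p \<longleftrightarrow> s\<^sup>2 + s * t = 0 \<and> s\<^sup>2 - s * t = 1)"
proof -
  note A = Aut_rel_Aut[OF \<alpha>(1)] and B = Aut_rel_Aut[OF \<beta>(1)]
  have neq: "e1 \<noteq> e2" "e1 \<noteq> e3" "e4 \<noteq> e3" "e2 \<noteq> e3"
    using perp e R_irrefl by blast+
  define v3 where "v3 = \<psi> e3"
  have r3: "rep e3 v3" unfolding v3_def using rep_\<psi> e(3) .
  obtain u1 where r1: "rep e1 u1" and rp: "rep p (u1 + v3)"
    using third_point_rep[OF e(1) r3 neq(2) p] .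
  obtain u4 where u4: "rep e4 u4" "rep q (u4 + v3)"
    using third_point_rep[OF e(4) r3 neq(3) q] .
  \<comment> \<open>The sign gives \<open>q\<close> the form \<open>[v3 - v4]\<close> used by the
    lemmas on automorphisms.\<close>
  define v4 where "v4 = (- 1) \<cdot> u4"
  have r4: "rep e4 v4" unfolding v4_def using rep_smul[OF u4(1)] one_in minus_in by simp
  have rq: "rep q (v3 - v4)"
    using u4(2) by (simp add: v4_def smul_def fun_diff_def plus_fun_def add.commute)
  have fix34: "\<forall>z a b. rep z (a \<cdot> v3 + b \<cdot> v4) \<longrightarrow> \<phi> z = z" if \<phi>: "\<phi> \<in> Aut_rel X R (line e1 e2)" for \<phi>
  proof (intro allI impI)
    fix z a b assume z: "rep z (a \<cdot> v3 + b \<cdot> v4)"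
    have "v3 \<bullet> \<psi> x = 0" "v4 \<bullet> \<psi> x = 0" if "x \<in> {e1, e2}" for x
      using rep_orth[OF r3 rep_\<psi>] rep_orth[OF r4 rep_\<psi>] that perp e R_sym by blast+
    then have "R z e1" "R z e2"
      using rep_orth[OF z rep_\<psi>] e by simp_all
    then show "\<phi> z = z" using Aut_rel_line_fixes[OF \<phi>] e repD(1)[OF z] by blast
  qed
  have fix3: "\<phi> e3 = e3" if "\<phi> \<in> Aut_rel X R (line e1 e2)" for \<phi>
    using fix34[OF that, rule_format, of e3 1 0] r3 by (simp add: plus_fun_def)
  obtain u2 where r2: "rep e2 u2" and rp2: "rep (\<beta> p) (u2 + v3)"
    using Aut_third_point_rep[OF B fix3[OF \<beta>(1)] e(1) r3 neq(2) p] \<beta>(2) by metis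
  have orth: "u1 \<bullet> u2 = 0" "u1 \<bullet> v3 = 0" "u1 \<bullet> v4 = 0" "u2 \<bullet> v3 = 0" "u2 \<bullet> v4 = 0" "v3 \<bullet> v4 = 0"
    using perp rep_orth r1 r2 r3 r4 by blast+
  then have orth': "u2 \<bullet> u1 = 0" "v3 \<bullet> u1 = 0" "v4 \<bullet> u1 = 0" "v3 \<bullet> u2 = 0" "v4 \<bullet> u2 = 0" "v4 \<bullet> v3 = 0"
    using herm_eq_0_sym by blast+
  note pos = rep_pos[OF r1] rep_pos[OF r2] rep_pos[OF r3]
  have n12: "u2 \<bullet> u2 = u1 \<bullet> u1"
    using Aut_norm_preserving[OF B fix34[OF \<beta>(1)] r3 r4 rq r1 _ _ _ _ _ _ rp rp2] r2 \<beta>(2) orth by metis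
  have "p \<noteq> \<beta> p"
  proof
    assume "p = \<beta> p"
    then have "u1 + v3 = u2 + v3" using rep_coeff_unique[OF rp rp2, of v3] orth pos by simp
    then show False using orth pos by simp
  qed
  have gX: "g \<in> X" and hX: "h \<in> X" using g(1) h(1) oline_subset[of X R e1 e2] by auto
  \<comment> \<open>On the line through \<open>e1\<close> and \<open>e2\<close> there is no
    \<open>v3\<close> component, so the coefficients of \<open>u1 + v3\<close> and
    \<open>u2 + v3\<close> add up to 0.\<close>
  have rg: "rep g (u1 - u2)"
  proof -
    obtain a b where ab: "\<psi> g = a \<cdot> u1 + b \<cdot> u2"
      using in_lineE[OF r1 r2 neq(1) g(1) rep_\<psi>[OF gX]] .
    obtain x y where xy: "\<psi> g = x \<cdot> (u1 + v3) + y \<cdot> (u2 + v3)"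
      using in_lineE[OF rp rp2 \<open>p \<noteq> \<beta> p\<close> g(2) rep_\<psi>[OF gX]] .
    have "\<psi> g \<bullet> v3 = 0" unfolding ab using orth by simp
    then have "x + y = 0" unfolding xy using orth pos by (simp flip: distrib_right)
    then have "y = - x" by (simp add: add_eq_0_iff)
    then have "\<psi> g = x \<cdot> (u1 - u2)" using xy by (simp add: fun_eq_iff algebra_simps)
    then show ?thesis using rep_unscale rep_\<psi>[OF gX] vecs_diff repD(2) r1 r2 by metis
  qed
  \<comment> \<open>Because \<open>u1\<close> and \<open>u2\<close> have equal length, the vectors
    in their plane orthogonal to \<open>u1 - u2\<close> are the multiples of
    \<open>u1 + u2\<close>.\<close>
  have rh: "rep h (u1 + u2)"
  proof -
    obtain a b where ab: "\<psi> h = a \<cdot> u1 + b \<cdot> u2"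
      using in_lineE[OF r1 r2 neq(1) h(1) rep_\<psi>[OF hX]] .
    have "\<psi> h \<bullet> (u1 - u2) = 0" using rep_orth[OF rg rep_\<psi>[OF hX]] h(2) herm_eq_0_sym by blast
    then have "(a - b) * (u1 \<bullet> u1) = 0" unfolding ab using orth orth' n12 by (simp add: algebra_simps)
    then have "a = b" using pos by simp
    then have "\<psi> h = a \<cdot> (u1 + u2)" using ab by (simp add: fun_eq_iff algebra_simps)
    then show ?thesis using rep_unscale rep_\<psi>[OF hX] vecs_add repD(2) r1 r2 by metis
  qed
  have hk: "\<alpha> e2 \<in> line e1 e2" "R h (\<alpha> e2)"
    using line_symmetryD(2)[OF line_in_lines[OF e(1,2) neq(1)] \<alpha>(1)] oline_endpoints(2)[OF orthoset e(1,2)]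
      Aut_orth_iff[OF A e(1,2)] perp(1) \<alpha>(2) by auto
  have kX: "\<alpha> e2 \<in> X" using Aut_in[OF A e(2)] .
  have rk: "rep (\<alpha> e2) (u1 - u2)"
  proof -
    obtain a b where ab: "\<psi> (\<alpha> e2) = a \<cdot> u1 + b \<cdot> u2"
      using in_lineE[OF r1 r2 neq(1) hk(1) rep_\<psi>[OF kX]] .
    have "\<psi> (\<alpha> e2) \<bullet> (u1 + u2) = 0" using rep_orth[OF rh rep_\<psi>[OF kX]] hk(2) herm_eq_0_sym by blast
    then have "(a + b) * (u1 \<bullet> u1) = 0" unfolding ab using orth orth' n12 by (simp add: algebra_simps)
    then have "b = - a" using pos by (simp add: add_eq_0_iff)
    then have "\<psi> (\<alpha> e2) = a \<cdot> (u1 - u2)" using ab by (simp add: fun_eq_iff algebra_simps)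
    then show ?thesis using rep_unscale rep_\<psi>[OF kX] vecs_diff repD(2) r1 r2 by metis
  qed
  \<comment> \<open>The point \<open>P\<close> selects the representative of
    \<open>\<alpha> e\<close> that corresponds to \<open>u\<close>. It has the length of
    \<open>u\<close>, which determines the modulus of its ratio \<open>c\<close> to the given
    \<open>w\<close>.\<close>
  have image: "\<exists>c\<in>K. rep (\<alpha> e) (c \<cdot> w) \<and> rep (\<alpha> P) (c \<cdot> w + v3) \<and> c * cnj c * (w \<bullet> w) = u \<bullet> u"
    if re: "rep e u" and ne: "e \<noteq> e3" and rP: "rep P (u + v3)" and rw: "rep (\<alpha> e) w"
      and o: "u \<bullet> v3 = 0" "u \<bullet> v4 = 0" "w \<bullet> v3 = 0" "w \<bullet> v4 = 0" for e u P w
  proof -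
    have eX: "e \<in> X" using repD(1)[OF re] .
    have o': "v3 \<bullet> u = 0" using o herm_eq_0_sym by blast
    have "P \<in> line e e3" using in_lineI[OF re r3, of P 1 1] rP by simp
    moreover have "P \<noteq> e" "P \<noteq> e3"
    proof -
      have "(u + v3) \<bullet> v3 \<noteq> 0" "(u + v3) \<bullet> u \<noteq> 0" using o o' pos rep_pos[OF re] by simp_all
      then show "P \<noteq> e" "P \<noteq> e3"
        using rep_orth[OF rP] rep_orth[OF re r3] rep_orth[OF r3 re] r3 re o o' by metis+
    qed
    ultimately obtain w' where w': "rep (\<alpha> e) w'" "rep (\<alpha> P) (w' + v3)"
      using Aut_third_point_rep[OF A fix3[OF \<alpha>(1)] eX r3 ne] by metis
    then obtain c where c: "c \<in> K" "w' = c \<cdot> w" using rep_proportional[OF rw] by metis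
    have "w' \<bullet> v3 = 0" "w' \<bullet> v4 = 0" unfolding c(2) using o by simp_all
    then have "w' \<bullet> w' = u \<bullet> u"
      using Aut_norm_preserving[OF A fix34[OF \<alpha>(1)] r3 r4 rq re w'(1) _ _ _ _ _ rP w'(2)] orth o by blast
    then have "c * cnj c * (w \<bullet> w) = u \<bullet> u" unfolding c(2) by (simp add: ac_simps)
    then show ?thesis using c(1) w' unfolding c(2) by blast
  qed
  have nn: "(u1 + u2) \<bullet> (u1 + u2) = 2 * (u1 \<bullet> u1)" "(u1 - u2) \<bullet> (u1 - u2) = 2 * (u1 \<bullet> u1)"
    using orth orth' n12 by simp_all
  have po: "(u1 + u2) \<bullet> v3 = 0" "(u1 + u2) \<bullet> v4 = 0" "(u1 - u2) \<bullet> v3 = 0" "(u1 - u2) \<bullet> v4 = 0"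
    using orth by simp_all
  obtain l where l: "l \<in> K" "rep h (l \<cdot> (u1 + u2))" "rep (\<alpha> p) (l \<cdot> (u1 + u2) + v3)"
      "l * cnj l * (2 * (u1 \<bullet> u1)) = u1 \<bullet> u1"
    using image[OF r1 neq(2) rp rh[folded \<alpha>(2)] orth(2,3) po(1,2)] unfolding \<alpha>(2) nn by blast
  obtain m where m: "m \<in> K" "rep (\<alpha> e2) (m \<cdot> (u1 - u2))" "rep (\<alpha> (\<beta> p)) (m \<cdot> (u1 - u2) + v3)"
      "m * cnj m * (2 * (u1 \<bullet> u1)) = u1 \<bullet> u1"
    using image[OF r2 neq(4) rp2 rk orth(4,5) po(3,4)] unfolding n12 nn by blast
  have norms: "2 * (l * cnj l) = 1" "2 * (m * cnj m) = 1"
    using l(4) m(4) pos by (simp_all add: mult_ac)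
  have "l \<noteq> 0" using norms by auto
  define w1 w2 where "w1 = l \<cdot> (u1 + u2)" and "w2 = m \<cdot> (u1 - u2)"
  have worth: "w1 \<bullet> v3 = 0" "w1 \<bullet> v4 = 0" "w2 \<bullet> v3 = 0" "w2 \<bullet> v4 = 0" "w1 \<bullet> w2 = 0" "w2 \<bullet> w1 = 0"
    unfolding w1_def w2_def using orth orth' n12 by simp_all
  have worth': "v3 \<bullet> w1 = 0" "v3 \<bullet> w2 = 0" using worth herm_eq_0_sym by blast+
  have rw: "rep (\<alpha> e1) w1" "rep (\<alpha> e2) w2" "rep (\<alpha> p) (w1 + v3)" "rep (\<alpha> (\<beta> p)) (w2 + v3)"
    using l m \<alpha>(2) by (simp_all add: w1_def w2_def)
  note wpos = rep_pos[OF rw(1)] rep_pos[OF rw(2)]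
  define y where "y = w1 + v3"
  have yr: "y \<in> reps" unfolding y_def using rep_reps rw(3) .
  \<comment> \<open>Rejecting one of \<open>u1\<close>, \<open>u2\<close> from the vector
    \<open>y\<close> of \<open>\<alpha> p\<close> yields points of the form to which
    \<open>Aut_scalar_transport\<close> applies.\<close>
  have "reject n u2 y = l \<cdot> u1 + v3" "reject n u1 y = l \<cdot> u2 + v3"
    unfolding reject_def y_def w1_def using orth orth' pos by (simp_all add: smul_distrib)
  then have "l \<cdot> u1 + v3 \<in> reps" "l \<cdot> u2 + v3 \<in> reps"
    using reps_reject[OF rep_reps[OF r1] yr] reps_reject[OF rep_reps[OF r2] yr] by auto
  moreover have "l \<cdot> u1 + v3 \<noteq> 0" "l \<cdot> u2 + v3 \<noteq> 0"
  proof -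
    have "(l \<cdot> u1 + v3) \<bullet> v3 \<noteq> 0" "(l \<cdot> u2 + v3) \<bullet> v3 \<noteq> 0" using orth pos by simp_all
    then show "l \<cdot> u1 + v3 \<noteq> 0" "l \<cdot> u2 + v3 \<noteq> 0" by (metis herm_linear(4))+
  qed
  ultimately obtain P1 P2 where P1: "rep P1 (l \<cdot> u1 + v3)" and P2: "rep P2 (l \<cdot> u2 + v3)"
    using repsE by metis
  have P1': "rep (\<alpha> P1) (l \<cdot> w1 + v3)"
    using Aut_scalar_transport[OF A fix34[OF \<alpha>(1)] r3 r4 rq r1 rw(1) _ _ _ _ _ rp rw(3) P1] orth worth by blast
  have P2': "rep (\<alpha> P2) (l \<cdot> w2 + v3)"
    using Aut_scalar_transport[OF A fix34[OF \<alpha>(1)] r3 r4 rq r2 rw(2) _ _ _ _ _ rp2 rw(4) P2] orth worth by blast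
  \<comment> \<open>\<open>\<alpha> p\<close> lies on the line through \<open>P1\<close> and
    \<open>e2\<close> and on the line through \<open>P2\<close> and \<open>e1\<close>. All four
    images are known, so \<open>\<alpha> (\<alpha> p)\<close> is located as the meet of the image
    lines.\<close>
  have "w1 + v3 = 1 \<cdot> (l \<cdot> u1 + v3) + l \<cdot> u2" "w1 + v3 = 1 \<cdot> (l \<cdot> u2 + v3) + l \<cdot> u1"
    by (simp_all add: w1_def fun_eq_iff algebra_simps)
  then obtain a b a' b' where ab: "rep (\<alpha> (\<alpha> p)) (a \<cdot> (l \<cdot> w1 + v3) + b \<cdot> w2)"
    and ab': "rep (\<alpha> (\<alpha> p)) (a' \<cdot> (l \<cdot> w2 + v3) + b' \<cdot> w1)"
    using rep_Aut_line[OF A P1 r2 _ P1' rw(2)] rep_Aut_line[OF A P2 r1 _ P2' rw(1)] rw(3) by metis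
  obtain k where k: "k \<noteq> 0" "a' \<cdot> (l \<cdot> w2 + v3) + b' \<cdot> w1 = k \<cdot> (a \<cdot> (l \<cdot> w1 + v3) + b \<cdot> w2)"
    using rep_proportional[OF ab ab'] .
  from arg_cong[OF k(2), of "\<lambda>v. v \<bullet> v3"] have k3: "a' = k * a" using worth worth' pos by simp
  from arg_cong[OF k(2), of "\<lambda>v. v \<bullet> w2"] have "a' * l = k * b" using worth worth' wpos by simp
  then have "b = a * l" using k3 k(1) by simp
  then have "a \<cdot> (l \<cdot> w1 + v3) + b \<cdot> w2 = a \<cdot> (l \<cdot> w1 + l \<cdot> w2 + v3)"
    by (simp add: fun_eq_iff algebra_simps)
  moreover have "l \<cdot> w1 + l \<cdot> w2 + v3 \<in> V"
    using repD(2)[OF rw(1)] repD(2)[OF rw(2)] repD(2)[OF r3] l(1) by (intro vecs_in)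
  ultimately have "rep (\<alpha> (\<alpha> p)) (l \<cdot> w1 + l \<cdot> w2 + v3)" using rep_unscale ab by metis
  moreover have "l \<cdot> w1 + l \<cdot> w2 + v3 = (l\<^sup>2 + l * m) \<cdot> u1 + (l\<^sup>2 - l * m) \<cdot> u2 + v3"
    by (simp add: w1_def w2_def fun_eq_iff algebra_simps power2_eq_square)
  ultimately have rpp: "rep (\<alpha> (\<alpha> p)) ((l\<^sup>2 + l * m) \<cdot> u1 + (l\<^sup>2 - l * m) \<cdot> u2 + v3)" by simp
  \<comment> \<open>With the \<open>v3\<close> component normalized to 1, \<open>p\<close> has
    coordinates \<open>(1, 0)\<close> and \<open>\<beta> p\<close> has coordinates
    \<open>(0, 1)\<close>.\<close>
  have coeffs: "s \<cdot> u1 + t \<cdot> u2 + v3 = s' \<cdot> u1 + t' \<cdot> u2 + v3 \<longleftrightarrow> s = s' \<and> t = t'" for s t s' t'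
    using orthogonal_coeffs(1,2)[of u1 u2 v3 s t 1 s' t' 1] pos orth by auto
  have "\<alpha> (\<alpha> p) = p \<longleftrightarrow> l\<^sup>2 + l * m = 1 \<and> l\<^sup>2 - l * m = 0"
    using rep_coeff_unique[OF rpp rp, of v3] coeffs[of _ _ 1 0] orth pos by simp
  moreover have "\<alpha> (\<alpha> p) = \<beta> p \<longleftrightarrow> l\<^sup>2 + l * m = 0 \<and> l\<^sup>2 - l * m = 1"
    using rep_coeff_unique[OF rpp rp2, of v3] coeffs[of _ _ 0 1] orth pos by simp
  ultimately show ?thesis using l(1) m(1) norms by blast
qed

text \<open>The configuration is described by \<open>X\<close> and \<open>R\<close> alone, so one
  choice of it can be read in two different representations.\<close>

lemma ex_rotation_configuration:
  assumes "n \<ge> 4"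
  obtains e1 e2 e3 e4 p q g h \<alpha> \<beta> where
    "e1 \<in> X" "e2 \<in> X" "e3 \<in> X" "e4 \<in> X"
    "R e1 e2" "R e1 e3" "R e1 e4" "R e2 e3" "R e2 e4" "R e3 e4"
    "p \<in> line e1 e3" "p \<noteq> e1" "p \<noteq> e3" "q \<in> line e4 e3" "q \<noteq> e4" "q \<noteq> e3"
    "\<beta> \<in> Aut_rel X R (line e1 e2)" "\<beta> e1 = e2" "g \<in> line e1 e2" "g \<in> line p (\<beta> p)"
    "h \<in> line e1 e2" "R g h" "\<alpha> \<in> Aut_rel X R (line e1 e2)" "\<alpha> e1 = h"
proof -
  obtain A where A: "A \<subseteq> X" "pairwise R A" "card A = n" by (rule ex_orthogonal_basis)
  obtain B where B: "B \<subseteq> A" "card B = 4" using obtain_subset_with_card_n A(3) assms by metis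
  then obtain e1 e2 e3 e4 where es: "B = {e1, e2, e3, e4}" "distinct [e1, e2, e3, e4]"
    by (auto simp: numeral_eq_Suc card_Suc_eq)
  then have e: "e1 \<in> X" "e2 \<in> X" "e3 \<in> X" "e4 \<in> X"
    and perp: "R e1 e2" "R e1 e3" "R e1 e4" "R e2 e3" "R e2 e4" "R e3 e4"
    using A B by (auto simp: pairwise_def)
  have neq: "e1 \<noteq> e2" "e1 \<noteq> e3" using es by auto
  obtain p where p: "p \<in> line e1 e3" "p \<noteq> e1" "p \<noteq> e3" using ex_third_point[OF e(1,3) perp(2)] .
  have "R e4 e3" using R_sym e perp by blast
  then obtain q where q: "q \<in> line e4 e3" "q \<noteq> e4" "q \<noteq> e3" using ex_third_point[OF e(4,3)] by blast
  note l12 = line_in_lines[OF e(1,2) neq(1)] and l12_points = oline_endpoints[OF orthoset e(1,2)]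
  obtain \<beta> where \<beta>: "\<beta> \<in> Aut_rel X R (line e1 e2)" "\<beta> e1 = e2"
    using line_symmetryD(3)[OF l12 l12_points] by blast
  have "R e3 e1" "R e3 e2" using R_sym e perp by blast+
  then have \<beta>3: "\<beta> e3 = e3" using Aut_rel_line_fixes[OF \<beta>(1) e(1-3)] by blast
  define v3 where "v3 = \<psi> e3"
  have r3: "rep e3 v3" unfolding v3_def using rep_\<psi> e(3) .
  obtain u1 where r1: "rep e1 u1" and rp: "rep p (u1 + v3)"
    using third_point_rep[OF e(1) r3 neq(2) p] .
  obtain u2 where r2: "rep e2 u2" and rp2: "rep (\<beta> p) (u2 + v3)"
    using Aut_third_point_rep[OF Aut_rel_Aut[OF \<beta>(1)] \<beta>3 e(1) r3 neq(2) p] \<beta>(2) by metis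
  have orth: "u1 \<bullet> u2 = 0" "u1 \<bullet> v3 = 0" "u2 \<bullet> v3 = 0"
    using perp rep_orth r1 r2 r3 by blast+
  \<comment> \<open>The lines through \<open>e1\<close>, \<open>e2\<close> and through
    \<open>p\<close>, \<open>\<beta> p\<close> are coplanar in the span of \<open>u1\<close>,
    \<open>u2\<close>, \<open>v3\<close>; their meet becomes \<open>g\<close>.\<close>
  have "1 \<cdot> (u1 + v3) - 1 \<cdot> (u2 + v3) \<in> reps"
    by (rule meet_reps[where A = u1 and B = u2 and C = v3 and a = 1 and b = 0 and a' = 0 and b' = 1])
      (use rep_reps r1 r2 r3 rp rp2 rep_pos orth in \<open>auto simp: one_in\<close>)
  then have "u1 - u2 \<in> reps" by simp
  moreover have "u1 - u2 \<noteq> 0"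
  proof -
    have "(u1 - u2) \<bullet> u2 \<noteq> 0" using orth rep_pos[OF r2] by simp
    then show ?thesis by (metis herm_linear(4))
  qed
  ultimately obtain g where rg: "rep g (u1 - u2)" using repsE by blast
  have "u1 - u2 = 1 \<cdot> u1 + (-1) \<cdot> u2" "u1 - u2 = 1 \<cdot> (u1 + v3) + (-1) \<cdot> (u2 + v3)"
    by (simp_all add: fun_eq_iff)
  then have g: "g \<in> line e1 e2" "g \<in> line p (\<beta> p)"
    using in_lineI[OF r1 r2] in_lineI[OF rp rp2] rg by metis+
  \<comment> \<open>Since \<open>\<gamma>\<close> preserves the line and takes \<open>e1\<close> to
    \<open>g\<close>, it takes \<open>e2\<close> to a point of the line orthogonal to
    \<open>g\<close>; this is the required \<open>h\<close>.\<close>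
  obtain \<gamma> where \<gamma>: "\<gamma> \<in> Aut_rel X R (line e1 e2)" "\<gamma> e1 = g"
    using line_symmetryD(3)[OF l12 l12_points(1) g(1)] by blast
  have h: "\<gamma> e2 \<in> line e1 e2" "R g (\<gamma> e2)"
    using line_symmetryD(2)[OF l12 \<gamma>(1)] l12_points(2)
      Aut_orth_iff[OF Aut_rel_Aut[OF \<gamma>(1)] e(1,2)] perp(1) \<gamma>(2) by auto
  obtain \<alpha> where \<alpha>: "\<alpha> \<in> Aut_rel X R (line e1 e2)" "\<alpha> e1 = \<gamma> e2"
    using line_symmetryD(3)[OF l12 l12_points(1) h(1)] by blast
  show thesis by (rule that[OF e perp p q \<beta> g h \<alpha>])
qed

end

section \<open>The two fields\<close>

definition subfield_of_reals :: "real set \<Rightarrow> bool" where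
  "subfield_of_reals M \<longleftrightarrow>
    1 \<in> M \<and> (\<forall>a\<in>M. \<forall>b\<in>M. a - b \<in> M \<and> a * b \<in> M) \<and> (\<forall>a\<in>M. inverse a \<in> M)"

lemma subfield_of_reals_closed:
  assumes "subfield_of_reals M"
  shows "1 \<in> M" "0 \<in> M" "a \<in> M \<Longrightarrow> b \<in> M \<Longrightarrow> a - b \<in> M" "a \<in> M \<Longrightarrow> b \<in> M \<Longrightarrow> a * b \<in> M"
    "a \<in> M \<Longrightarrow> inverse a \<in> M" "a \<in> M \<Longrightarrow> - a \<in> M" "a \<in> M \<Longrightarrow> b \<in> M \<Longrightarrow> a + b \<in> M"
    "a \<in> M \<Longrightarrow> b \<in> M \<Longrightarrow> a / b \<in> M" "a \<in> M \<Longrightarrow> a ^ k \<in> M"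
proof -
  have base: "1 \<in> M" "\<And>a b. a \<in> M \<Longrightarrow> b \<in> M \<Longrightarrow> a - b \<in> M" "\<And>a b. a \<in> M \<Longrightarrow> b \<in> M \<Longrightarrow> a * b \<in> M"
    "\<And>a. a \<in> M \<Longrightarrow> inverse a \<in> M"
    using assms by (auto simp: subfield_of_reals_def)
  have zero: "0 \<in> M" using base(2)[OF base(1) base(1)] by simp
  have minus: "- a \<in> M" if "a \<in> M" for a using base(2)[OF zero that] by simp
  show "1 \<in> M" "0 \<in> M" "a \<in> M \<Longrightarrow> b \<in> M \<Longrightarrow> a - b \<in> M" "a \<in> M \<Longrightarrow> b \<in> M \<Longrightarrow> a * b \<in> M"
    "a \<in> M \<Longrightarrow> inverse a \<in> M" "a \<in> M \<Longrightarrow> - a \<in> M"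
    using base zero minus by auto
  show "a + b \<in> M" if "a \<in> M" "b \<in> M" using base(2)[OF that(1) minus[OF that(2)]] by simp
  show "a \<in> M \<Longrightarrow> b \<in> M \<Longrightarrow> a / b \<in> M" using base by (simp add: divide_inverse)
  show "a \<in> M \<Longrightarrow> a ^ k \<in> M" using base by (induction k) auto
qed

lemma Rats_subset_subfield:
  assumes "subfield_of_reals M"
  shows "\<rat> \<subseteq> M"
proof
  note closed = subfield_of_reals_closed[OF assms]
  have nat: "of_nat k \<in> M" for k by (induction k) (auto intro: closed)
  have int: "of_int i \<in> M" for i
    by (cases i) (auto intro!: closed(6) simp: nat simp del: of_nat_Suc)
  fix x :: real assume "x \<in> \<rat>"
  then obtain a b where "x = of_int a / of_int b" by (auto elim: Rats_cases')
  then show "x \<in> M" using int closed(8) by simp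
qed

lemma sqrt_2_not_rat: "sqrt 2 \<notin> \<rat>"
proof
  assume "sqrt 2 \<in> \<rat>"
  then obtain m n :: nat where mn: "n \<noteq> 0" "\<bar>sqrt 2\<bar> = real m / real n" "coprime m n"
    by (rule Rats_abs_nat_div_natE)
  then have "real m = sqrt 2 * real n" by (simp add: field_simps)
  then have "real (m\<^sup>2) = real (2 * n\<^sup>2)" by (simp add: power_mult_distrib)
  then have eq: "m\<^sup>2 = 2 * n\<^sup>2" unfolding of_nat_eq_iff .
  then have "even m" by (metis dvd_triv_left even_power)
  then obtain k where "m = 2 * k" by auto
  then have "n\<^sup>2 = 2 * k\<^sup>2" using eq by (simp add: power2_eq_square)
  then have "even n" by (metis dvd_triv_left even_power)
  then show False using \<open>even m\<close> mn(3) by (meson coprime_common_divisor odd_one)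
qed

text \<open>Names for the real numbers obtained from 1 by field operations and square roots.
  Countability of the terms makes the field of their values countable.\<close>

datatype sqrt_term =
  Unit | Sub sqrt_term sqrt_term | Mult sqrt_term sqrt_term | Inv sqrt_term | Sqrt sqrt_term

instance sqrt_term :: countable
  by countable_datatype

primrec sqrt_value :: "sqrt_term \<Rightarrow> real" where
  "sqrt_value Unit = 1"
| "sqrt_value (Sub a b) = sqrt_value a - sqrt_value b"
| "sqrt_value (Mult a b) = sqrt_value a * sqrt_value b"
| "sqrt_value (Inv a) = inverse (sqrt_value a)"
| "sqrt_value (Sqrt a) = sqrt (sqrt_value a)"

lemma subfield_range_sqrt_value: "subfield_of_reals (range sqrt_value)"
  unfolding subfield_of_reals_def
  by (auto simp: image_iff) (metis sqrt_value.simps)+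

lemma sqrt_in_range_sqrt_value: "a \<in> range sqrt_value \<Longrightarrow> sqrt a \<in> range sqrt_value"
  by (metis rangeE rangeI sqrt_value.simps(5))

text \<open>Zorn's lemma, with the rationals as a starting point. Two elements of the union of a
  chain lie in a common member, so the union is a subfield again.\<close>

lemma ex_maximal_subfield_without_sqrt_2:
  assumes E: "subfield_of_reals E"
  obtains M where "subfield_of_reals M" "M \<subseteq> E" "sqrt 2 \<notin> M"
    "\<forall>N. subfield_of_reals N \<and> N \<subseteq> E \<and> sqrt 2 \<notin> N \<and> M \<subseteq> N \<longrightarrow> N = M"
proof -
  let ?A = "{M. subfield_of_reals M \<and> M \<subseteq> E \<and> sqrt 2 \<notin> M}"
  have "subfield_of_reals \<rat>"
    by (auto simp: subfield_of_reals_def)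
  then have "\<rat> \<in> ?A" using Rats_subset_subfield[OF E] sqrt_2_not_rat by simp
  then have "?A \<noteq> {}" by blast
  moreover have "\<Union>C \<in> ?A" if C: "C \<noteq> {}" "subset.chain ?A C" for C
  proof -
    have sub: "C \<subseteq> ?A" and total: "\<And>M N. M \<in> C \<Longrightarrow> N \<in> C \<Longrightarrow> M \<subseteq> N \<or> N \<subseteq> M"
      using C(2) by (auto simp: subset_chain_def)
    have common: "\<exists>M\<in>C. a \<in> M \<and> b \<in> M" if ab: "a \<in> \<Union>C" "b \<in> \<Union>C" for a b
    proof -
      obtain M N where "M \<in> C" "a \<in> M" "N \<in> C" "b \<in> N" using ab by blast
      then show ?thesis using total[of M N] by blast
    qed
    have "subfield_of_reals (\<Union>C)"
      unfolding subfield_of_reals_def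
    proof (intro conjI ballI)
      have field: "subfield_of_reals M" if "M \<in> C" for M using that sub by blast
      obtain M where M: "M \<in> C" using C(1) by blast
      then show "1 \<in> \<Union>C" using subfield_of_reals_closed(1)[OF field[OF M]] by blast
      show "a - b \<in> \<Union>C" "a * b \<in> \<Union>C" if ab: "a \<in> \<Union>C" "b \<in> \<Union>C" for a b
      proof -
        obtain M where M: "M \<in> C" "a \<in> M" "b \<in> M" using common[OF ab] by blast
        then show "a - b \<in> \<Union>C" "a * b \<in> \<Union>C"
          using subfield_of_reals_closed(3,4)[OF field[OF M(1)] M(2,3)] by blast+
      qed
      show "inverse a \<in> \<Union>C" if a: "a \<in> \<Union>C" for a
      proof -
        obtain M where M: "M \<in> C" "a \<in> M" using a by blast
        then show ?thesis using subfield_of_reals_closed(5)[OF field[OF M(1)] M(2)] by blast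
      qed
    qed
    moreover have "\<Union>C \<subseteq> E" "sqrt 2 \<notin> \<Union>C" using sub by auto
    ultimately show ?thesis by simp
  qed
  ultimately have "\<exists>M\<in>?A. \<forall>N\<in>?A. M \<subseteq> N \<longrightarrow> N = M"
    by (rule subset_Zorn_nonempty)
  then obtain M where M: "M \<in> ?A" "\<forall>N\<in>?A. M \<subseteq> N \<longrightarrow> N = M" by blast
  show thesis by (rule that[of M]) (use M in simp_all)
qed

text \<open>Inverses are formed with the conjugate \<open>a - b * sqrt s\<close>. The norm
  \<open>a\<^sup>2 - b\<^sup>2 * s\<close> vanishes only for \<open>a = b = 0\<close>, since
  otherwise \<open>sqrt s\<close> would be a quotient of elements of \<open>M\<close>.\<close>

lemma subfield_adjoin_sqrt:
  assumes M: "subfield_of_reals M" and s: "s \<in> M" "s > 0" "sqrt s \<notin> M"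
  shows "subfield_of_reals {a + b * sqrt s | a b. a \<in> M \<and> b \<in> M}" (is "subfield_of_reals ?N")
proof -
  note closed = subfield_of_reals_closed[OF M]
  have s2: "sqrt s * sqrt s = s" using s(2) by simp
  have NI: "x \<in> ?N" if "x = a + b * sqrt s" "a \<in> M" "b \<in> M" for x a b using that by blast
  show ?thesis unfolding subfield_of_reals_def
  proof (intro conjI ballI)
    show "1 \<in> ?N" by (rule NI[of _ 1 0]) (auto intro: closed)
    fix x assume "x \<in> ?N"
    then obtain a b where x: "x = a + b * sqrt s" "a \<in> M" "b \<in> M" by blast
    show "inverse x \<in> ?N"
    proof (cases "a = 0 \<and> b = 0")
      case True
      then show ?thesis using x by (intro NI[of _ 0 0]) (auto intro: closed)
    next
      case False
      have "a - b * sqrt s \<noteq> 0"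
      proof
        assume "a - b * sqrt s = 0"
        then have "b \<noteq> 0" "sqrt s = a / b" using False by (auto simp: field_simps)
        then show False using s(3) closed(8) x by metis
      qed
      moreover have "a + b * sqrt s \<noteq> 0"
      proof
        assume z: "a + b * sqrt s = 0"
        then have "b \<noteq> 0" using False by auto
        with z have "sqrt s = - a / b" by (simp add: field_simps add_eq_0_iff)
        then show False using s(3) closed(6,8) x by metis
      qed
      moreover have "(a + b * sqrt s) * (a - b * sqrt s) = a\<^sup>2 - b\<^sup>2 * s"
        using s2 by (simp add: algebra_simps power2_eq_square)
      ultimately have d: "a\<^sup>2 - b\<^sup>2 * s \<noteq> 0" "inverse x = (a - b * sqrt s) / (a\<^sup>2 - b\<^sup>2 * s)"
        unfolding x(1) by (metis mult_eq_0_iff, metis divide_divide_eq_right inverse_eq_divide mult.commute nonzero_mult_div_cancel_left mult_1 times_divide_eq_right nonzero_divide_mult_cancel_right)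
      show ?thesis
        by (rule NI[of _ "a / (a\<^sup>2 - b\<^sup>2 * s)" "- b / (a\<^sup>2 - b\<^sup>2 * s)"])
          (use d x s(1) in \<open>auto intro!: closed simp: diff_divide_distrib\<close>)
    qed
    fix y assume "y \<in> ?N"
    then obtain c d where y: "y = c + d * sqrt s" "c \<in> M" "d \<in> M" by blast
    show "x - y \<in> ?N"
      by (rule NI[of _ "a - c" "b - d"]) (use x y in \<open>auto intro: closed simp: algebra_simps\<close>)
    have "x * y = (a * c + b * d * s) + (a * d + b * c) * sqrt s"
      unfolding x y using s2 by (simp add: algebra_simps)
    then show "x * y \<in> ?N"
      by (rule NI) (use x y s(1) in \<open>auto intro!: closed\<close>)
  qed
qed

text \<open>If \<open>sqrt s\<close> is not in \<open>M\<close>, adjoining it must produce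
  \<open>sqrt 2 = a + b * sqrt s\<close>. After squaring, \<open>a * b = 0\<close>, for otherwise
  \<open>sqrt s\<close> would lie in \<open>M\<close>; \<open>b = 0\<close> would put
  \<open>sqrt 2\<close> into \<open>M\<close>. Hence \<open>b\<^sup>2 * s = 2\<close>.\<close>

lemma maximal_subfield_square_or_double_square:
  assumes E: "subfield_of_reals E" "\<And>a. a \<in> E \<Longrightarrow> sqrt a \<in> E"
    and M: "subfield_of_reals M" "M \<subseteq> E" "sqrt 2 \<notin> M"
    and max: "\<forall>N. subfield_of_reals N \<and> N \<subseteq> E \<and> sqrt 2 \<notin> N \<and> M \<subseteq> N \<longrightarrow> N = M"
    and s: "s \<in> M" "s \<ge> 0"
  shows "\<exists>t\<in>M. s = t\<^sup>2 \<or> s = 2 * t\<^sup>2"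
proof (cases "sqrt s \<in> M")
  case True
  then show ?thesis using s(2) by (metis real_sqrt_pow2)
next
  case False
  note closed = subfield_of_reals_closed[OF M(1)] and closedE = subfield_of_reals_closed[OF E(1)]
  have "s > 0" using s False closed(2) by (cases "s = 0") auto
  define N where "N = {a + b * sqrt s | a b. a \<in> M \<and> b \<in> M}"
  have N: "subfield_of_reals N" unfolding N_def using M(1) s(1) \<open>s > 0\<close> False by (rule subfield_adjoin_sqrt)
  have "N \<subseteq> E" unfolding N_def using M(2) E(2) s(1) by (auto intro!: closedE)
  moreover have "a \<in> N" if "a \<in> M" for a
    unfolding N_def using that closed(2) by (force intro: exI[of _ a] exI[of _ 0])
  moreover have "sqrt s \<in> N"
    unfolding N_def using closed(1,2) by (force intro: exI[of _ 0] exI[of _ 1])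
  ultimately have "sqrt 2 \<in> N" using max N False by blast
  then obtain a b where ab: "sqrt 2 = a + b * sqrt s" "a \<in> M" "b \<in> M" unfolding N_def by blast
  have "(a + b * sqrt s)\<^sup>2 = 2" using ab(1) by (metis real_sqrt_pow2 zero_le_numeral)
  then have sq: "a\<^sup>2 + b\<^sup>2 * s + 2 * a * b * sqrt s = 2"
    using s(2) by (simp add: power2_sum power_mult_distrib algebra_simps)
  have "a * b = 0"
  proof (rule ccontr)
    assume nz: "a * b \<noteq> 0"
    then have "sqrt s = (2 - a\<^sup>2 - b\<^sup>2 * s) / (2 * a * b)" using sq by (simp add: field_simps)
    moreover have "2 \<in> M" using closed(7)[OF closed(1,1)] by simp
    ultimately have "sqrt s \<in> M" using ab s(1) by (auto intro!: closed)
    then show False using False by blast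
  qed
  moreover have "b \<noteq> 0" using ab M(3) by auto
  ultimately have "b\<^sup>2 * s = 2" using sq by simp
  then have "s = 2 * (1 / b)\<^sup>2" using \<open>b \<noteq> 0\<close> by (simp add: field_simps)
  then show ?thesis using closed(1,8) ab(3) by blast
qed

lemma conj_field_of_real:
  assumes "subfield_of_reals M"
  shows "conj_field (of_real ` M)"
proof unfold_locales
  note closed = subfield_of_reals_closed[OF assms]
  show "1 \<in> complex_of_real ` M" using closed(1) by (intro image_eqI[of _ _ 1]) simp_all
  fix a assume "a \<in> complex_of_real ` M"
  then obtain x where x: "x \<in> M" "a = of_real x" by blast
  show "inverse a \<in> of_real ` M" using closed(5) x by (intro image_eqI[of _ _ "inverse x"]) simp_all
  show "cnj a \<in> of_real ` M" using x by simp
  fix b assume "b \<in> complex_of_real ` M"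
  then obtain y where y: "y \<in> M" "b = of_real y" by blast
  show "a - b \<in> of_real ` M" using closed(3) x y by (intro image_eqI[of _ _ "x - y"]) simp_all
  show "a * b \<in> of_real ` M" using closed(4) x y by (intro image_eqI[of _ _ "x * y"]) simp_all
qed

lemma conj_field_complex:
  assumes "subfield_of_reals M"
  shows "conj_field {z. Re z \<in> M \<and> Im z \<in> M}"
  by unfold_locales (auto intro!: subfield_of_reals_closed[OF assms])

section \<open>Incompatibility of the two models\<close>

lemma herm_rep_comp_embedding:
  assumes "herm_rep K n Y S \<rho>" "orthoset_embedding X R Y S \<phi>"
  shows "herm_rep K n X R (\<rho> \<circ> \<phi>)"
proof -
  interpret Y: herm_rep K n Y S \<rho> by fact
  have \<phi>: "\<And>x. x \<in> X \<Longrightarrow> \<phi> x \<in> Y" "inj_on \<phi> X" "\<And>x y. x \<in> X \<Longrightarrow> y \<in> X \<Longrightarrow> R x y \<longleftrightarrow> S (\<phi> x) (\<phi> y)"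
    using assms(2) unfolding orthoset_embedding_def by blast+
  show ?thesis
  proof unfold_locales
    show "R x y \<longleftrightarrow> herm n ((\<rho> \<circ> \<phi>) x) ((\<rho> \<circ> \<phi>) y) = 0" if "x \<in> X" "y \<in> X" for x y
      unfolding \<phi>(3)[OF that] using Y.\<psi>_orth \<phi>(1) that by simp
    show "x = y" if "x \<in> X" "y \<in> X" "(\<rho> \<circ> \<phi>) x = c \<cdot> (\<rho> \<circ> \<phi>) y" for x y c
      using Y.\<psi>_inj[of "\<phi> x" "\<phi> y" c] \<phi>(1,2) that by (auto dest: inj_onD)
  qed (use Y.\<psi>_vecs Y.\<psi>_nonzero \<phi>(1) in auto)
qed

lemma no_common_embedding:
  assumes "n \<ge> 4" and X: "nonboolean_line_symmetric_orthoset n X R"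
    and real: "herm_rep (of_real ` E) n X R \<psi>"
    and K: "herm_rep K n X R \<chi>" "\<And>z. z \<in> K \<Longrightarrow> z\<^sup>2 \<noteq> 2"
  shows False
proof -
  interpret A: symmetric_rep "of_real ` E" n X R \<psi>
    using real X \<open>n \<ge> 4\<close> by (simp add: symmetric_rep_def symmetric_rep_axioms_def)
  interpret B: symmetric_rep K n X R \<chi>
    using K(1) X \<open>n \<ge> 4\<close> by (simp add: symmetric_rep_def symmetric_rep_axioms_def)
  obtain e1 e2 e3 e4 p q g h \<alpha> \<beta> where conf:
    "e1 \<in> X" "e2 \<in> X" "e3 \<in> X" "e4 \<in> X"
    "R e1 e2" "R e1 e3" "R e1 e4" "R e2 e3" "R e2 e4" "R e3 e4"
    "p \<in> oline X R e1 e3" "p \<noteq> e1" "p \<noteq> e3" "q \<in> oline X R e4 e3" "q \<noteq> e4" "q \<noteq> e3"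
    "\<beta> \<in> Aut_rel X R (oline X R e1 e2)" "\<beta> e1 = e2" "g \<in> oline X R e1 e2" "g \<in> oline X R p (\<beta> p)"
    "h \<in> oline X R e1 e2" "R g h" "\<alpha> \<in> Aut_rel X R (oline X R e1 e2)" "\<alpha> e1 = h"
    by (rule A.ex_rotation_configuration[OF \<open>n \<ge> 4\<close>])
  obtain s t where st: "s \<in> of_real ` E" "t \<in> of_real ` E" "2 * (s * cnj s) = 1" "2 * (t * cnj t) = 1"
    "\<alpha> (\<alpha> p) = p \<longleftrightarrow> s\<^sup>2 + s * t = 1 \<and> s\<^sup>2 - s * t = 0"
    "\<alpha> (\<alpha> p) = \<beta> p \<longleftrightarrow> s\<^sup>2 + s * t = 0 \<and> s\<^sup>2 - s * t = 1"
    using A.rotation_coordinates[OF conf] by blast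
  \<comment> \<open>For real scalars the norm conditions become
    \<open>s\<^sup>2 = t\<^sup>2 = 1/2\<close>. The case \<open>t = s\<close> gives
    \<open>\<alpha> (\<alpha> p) = p\<close>, the case \<open>t = - s\<close> gives
    \<open>\<alpha> (\<alpha> p) = \<beta> p\<close>.\<close>
  have "cnj s = s" "cnj t = t" using st(1,2) by auto
  then have sq: "2 * s\<^sup>2 = 1" "2 * t\<^sup>2 = 1" using st(3,4) by (simp_all add: power2_eq_square)
  then have "s\<^sup>2 = t\<^sup>2" by (metis mult_cancel_left zero_neq_numeral)
  then have "t = s \<or> t = - s" by (auto simp: power2_eq_iff)
  then have two: "\<alpha> (\<alpha> p) = p \<or> \<alpha> (\<alpha> p) = \<beta> p"
    unfolding st(5,6) using sq(1) by (auto simp: power2_eq_square)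
  obtain s' t' where st': "s' \<in> K"
    "\<alpha> (\<alpha> p) = p \<longleftrightarrow> s'\<^sup>2 + s' * t' = 1 \<and> s'\<^sup>2 - s' * t' = 0"
    "\<alpha> (\<alpha> p) = \<beta> p \<longleftrightarrow> s'\<^sup>2 + s' * t' = 0 \<and> s'\<^sup>2 - s' * t' = 1"
    using B.rotation_coordinates[OF conf] by blast
  \<comment> \<open>Either alternative has the same sum of coordinates over \<open>K\<close>, and in
    this sum \<open>t'\<close> cancels; the inverse of \<open>s'\<close> is then a square root of
    2.\<close>
  have "(s'\<^sup>2 + s' * t') + (s'\<^sup>2 - s' * t') = 1"
    using two unfolding st'(2,3) by (metis add_0 add.right_neutral)
  then have "2 * s'\<^sup>2 = 1" by (simp add: algebra_simps)
  then have "s'\<^sup>2 = 1 / 2" by (simp add: field_simps)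
  then have "(inverse s')\<^sup>2 = inverse (1 / 2)" by (simp only: power_inverse)
  then have "(inverse s')\<^sup>2 = 2" by simp
  then show False using K(2) B.inverse_in[OF st'(1)] by blast
qed

theorem mainTheorem6:
  fixes n :: nat
  assumes "n \<ge> 4"
    and "infinite (UNIV :: 'b set)"
  shows "\<not> (\<exists>(X :: 'a set) R. nonboolean_line_symmetric_orthoset n X R \<and>
           (\<forall>(Y :: 'b set) S. nonboolean_line_symmetric_orthoset n Y S \<longrightarrow> embeds_into X R Y S))"
proof
  assume "\<exists>(X :: 'a set) R. nonboolean_line_symmetric_orthoset n X R \<and>
           (\<forall>(Y :: 'b set) S. nonboolean_line_symmetric_orthoset n Y S \<longrightarrow> embeds_into X R Y S)"
  then obtain X :: "'a set" and R where X: "nonboolean_line_symmetric_orthoset n X R"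
    and emb: "\<And>(Y :: 'b set) S. nonboolean_line_symmetric_orthoset n Y S \<Longrightarrow> embeds_into X R Y S"
    by blast
  have rep: "\<exists>\<psi>. herm_rep K n X R \<psi>"
    if K: "conj_field K" "countable K"
      "\<And>a b. a \<in> K \<Longrightarrow> b \<in> K \<Longrightarrow> \<exists>c\<in>K. (cmod c)\<^sup>2 = (cmod a)\<^sup>2 + (cmod b)\<^sup>2" for K
  proof -
    obtain Y :: "'b set" and S \<rho> where Y: "herm_model K n Y S \<rho>"
      using ex_herm_model[OF K(1,2) assms(2) K(3)] by blast
    then have "embeds_into X R Y S"
      using emb herm_model.nonboolean_line_symmetric assms(1) by fastforce
    then obtain \<phi> where "orthoset_embedding X R Y S \<phi>" by (auto simp: embeds_into_def)
    then show ?thesis using herm_rep_comp_embedding herm_model.axioms(1)[OF Y] by blast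
  qed
  define E where "E = range sqrt_value"
  have E: "subfield_of_reals E" "countable E" "\<And>a. a \<in> E \<Longrightarrow> sqrt a \<in> E"
    unfolding E_def using subfield_range_sqrt_value sqrt_in_range_sqrt_value by auto
  obtain M where M: "subfield_of_reals M" "M \<subseteq> E" "sqrt 2 \<notin> M"
    "\<forall>N. subfield_of_reals N \<and> N \<subseteq> E \<and> sqrt 2 \<notin> N \<and> M \<subseteq> N \<longrightarrow> N = M"
    by (rule ex_maximal_subfield_without_sqrt_2[OF E(1)])
  note closedE = subfield_of_reals_closed[OF E(1)] and closedM = subfield_of_reals_closed[OF M(1)]
  define F where "F = {z. Re z \<in> M \<and> Im z \<in> M}"
  have "\<exists>\<psi>. herm_rep (of_real ` E) n X R \<psi>"
  proof (rule rep)
    show "conj_field (of_real ` E)" by (rule conj_field_of_real[OF E(1)])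
    show "countable (of_real ` E)" using E(2) by blast
    fix a b :: complex assume "a \<in> of_real ` E" "b \<in> of_real ` E"
    then obtain x y where "x \<in> E" "y \<in> E" "a = of_real x" "b = of_real y" by blast
    then show "\<exists>c\<in>of_real ` E. (cmod c)\<^sup>2 = (cmod a)\<^sup>2 + (cmod b)\<^sup>2"
      using E(3) closedE(7,9) by (intro bexI[of _ "of_real (sqrt (x\<^sup>2 + y\<^sup>2))"]) auto
  qed
  moreover have "\<exists>\<chi>. herm_rep F n X R \<chi>"
  proof (rule rep)
    show "conj_field F" unfolding F_def by (rule conj_field_complex[OF M(1)])
    have "F \<subseteq> (\<lambda>(a, b). Complex a b) ` (M \<times> M)" unfolding F_def by (force simp: complex_eq_iff)
    moreover have "countable M" using E(2) M(2) countable_subset by blast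
    ultimately show "countable F" by (meson countable_SIGMA countable_image countable_subset)
    fix a b assume "a \<in> F" "b \<in> F"
    then have "(cmod a)\<^sup>2 + (cmod b)\<^sup>2 \<in> M"
      unfolding cmod_power2 F_def by (auto intro!: closedM)
    then obtain t where t: "t \<in> M" "(cmod a)\<^sup>2 + (cmod b)\<^sup>2 = t\<^sup>2 \<or> (cmod a)\<^sup>2 + (cmod b)\<^sup>2 = 2 * t\<^sup>2"
      using maximal_subfield_square_or_double_square[OF E(1,3) M] by fastforce
    have "Complex t 0 \<in> F" "Complex t t \<in> F" unfolding F_def using t(1) closedM by auto
    moreover have "(cmod (Complex t 0))\<^sup>2 = t\<^sup>2" "(cmod (Complex t t))\<^sup>2 = 2 * t\<^sup>2"
      by (simp_all add: cmod_power2)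
    ultimately show "\<exists>c\<in>F. (cmod c)\<^sup>2 = (cmod a)\<^sup>2 + (cmod b)\<^sup>2" using t(2) by metis
  qed
  moreover have "z\<^sup>2 \<noteq> 2" if "z \<in> F" for z
  proof
    assume "z\<^sup>2 = 2"
    then have "z\<^sup>2 = (of_real (sqrt 2))\<^sup>2" by (simp flip: of_real_power)
    then have "Re z = sqrt 2 \<or> Re z = - sqrt 2" by (auto simp: power2_eq_iff)
    then show False using that closedM(6)[of "Re z"] M(3) by (auto simp: F_def)
  qed
  ultimately show False using no_common_embedding[OF assms(1) X] by blast
qed

end
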